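(* Let $r\in\mathbb{N}\cup\{0\}$ and $k,n\in\mathbb{N}$ be such that $r\leq n$ and $k\leq n^2$. Let $\boldsymbol{\rho}=(\rho_1,\dots,\rho_k)$ be such that $\rho_\ell\in\mathbb{N}$ for $\ell\in[k]$ and $\sum_{\ell\in[k]}\rho_\ell=n^2$, and let $\boldsymbol{d}=(d_1,\dots,d_k)$ be such that $d_\ell\in\mathbb{N}\cup\{0\}$ for $\ell\in[k]$ and $\sum_{\ell\in[k]}d_\ell\leq n-r$. Let $Y=\{\ell\in[k] : n\nmid\rho_\ell\}$. Let $M$ be an $r\times r$ externally symmetric equitable $\boldsymbol{\rho}$-Latin rectangle on $[k]$. Then $M$ can be extended to an $n\times n$ equitable $\boldsymbol{\rho}$-Latin square on $[k]$ which is symmetric off $M$ and has the prescribed diagonal tail $\boldsymbol{d}$ if and only if $M$ is equitably $(\boldsymbol{\rho},\boldsymbol{d})$-admissible and the following two conditions hold: 1. For every $I\subseteq[r]$, $$|I|\Big(\sum_{\ell\in[k]}\left\lceil\frac{\rho_\ell}{n}\right\rceil-n\Big)\leq\sum_{\ell\in Y}\min\Big\{n\left\lceil\frac{\rho_\ell}{n}\right\rceil-\rho_\ell,\ \eta_I(\ell)\Big\}.$$ 2. For every $K\subseteq Y$, $$\sum_{\ell\in K}\max\Big\{r\left\lceil\frac{\rho_\ell}{n}\right\rceil-\left\lfloor\frac{\rho_\ell+|M_\ell|-d_\ell}{2}\right\rfloor,\ r\left(\left\lceil\frac{\rho_\ell}{n}\right\rceil-\left\lfloor\frac{\rho_\ell}{n}\right\rfloor\right)+n\left\lfloor\frac{\rho_\ell}{n}\right\rfloor-\rho_\ell,\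 0\Big\}\leq\sum_{i\in[r]}\min\Big\{\sum_{\ell\in[k]}\left\lceil\frac{\rho_\ell}{n}\right\rceil-n,\ \eta_K(i)\Big\}.$$
   Context: Notation: $[m]=\{1,\dots,m\}$ (with $[0]=\emptyset$). For an $s\times s$ array $A$ with symbols from $[k]$, $A(i,j)$ is the symbol in cell $(i,j)$; $|A_\ell|$ is the number of occurrences of symbol $\ell$ in $A$; $|A_\ell^i|$ is the number of occurrences of $\ell$ in row $i$ of $A$; $|{}^jA_\ell|$ is the number of occurrences of $\ell$ in column $j$ of $A$. An $r\times r$ array $M$ is an equitable $\boldsymbol{\rho}$-Latin rectangle (on $[k]$, relative to $n$) if every cell contains exactly one symbol from $[k]$, $|M_\ell|\leq\rho_\ell$ for all $\ell\in[k]$, and $|M_\ell^i|\leq\lceil\rho_\ell/n\rceil$ and $|{}^iM_\ell|\leq\lceil\rho_\ell/n\rceil$ for all $\ell\in[k]$, $i\in[r]$. An $n\times n$ array $N$ is an equitable $\boldsymbol{\rho}$-Latin square (on $[k]$) if every cell contains exactly one symbol from $[k]$, $|N_\ell|=\rho_\ell$ for all $\ell\in[k]$, and $\lfloor\rho_\ell/n\rfloor\leq|N_\ell^i|\leq\lceil\rho_\ell/n\rceil$ and $\lfloor\rho_\ell/n\rfloor\leq|{}^iN_\ell|\leq\lceil\rho_\ell/n\rceil$ for all $\ell\in[k]$, $i\in[n]$. An $r\times r$ array $M$ is externally symmetric if $|M_\ell^i|=|{}^iM_\ell|$ for all $i\in[r]$, $\ell\in[k]$. An $n\times n$ array $N$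 extends $M$ if $M$ is the top-left $r\times r$ subarray of $N$; write $N=\begin{bmatrix} M & A \\ B & C \end{bmatrix}$, where $C$ is $(n-r)\times(n-r)$. Then $N$ is symmetric off $M$ if $B=A^T$ and $C$ is symmetric with respect to its main diagonal ($M$ itself need not be symmetric). $N$ has the prescribed diagonal tail $\boldsymbol{d}$ if for each $\ell\in[k]$ there are at least $d_\ell$ occurrences of $\ell$ on the main diagonal of $C$. $M$ is equitably $(\boldsymbol{\rho},\boldsymbol{d})$-admissible if all of the following hold: (a) $|M_\ell|+d_\ell\leq\rho_\ell$ for all $\ell\in[k]$; (b) $(n-r)\lfloor\rho_\ell/n\rfloor\leq\rho_\ell-|M_\ell|\leq2(n-r)\lceil\rho_\ell/n\rceil-d_\ell$ for all $\ell\in[k]$; (c) $\big|\{\ell\in[k]:\rho_\ell-|M_\ell|-d_\ell\not\equiv0\pmod 2\}\big|\leq n-r-\sum_{\ell\in[k]}d_\ell$; (d) $n-r-\sum_{\ell\in[k]}d_\ell\equiv\big|\{\ell\in[k]:\rho_\ell-|M_\ell|-d_\ell\text{ is odd}\}\big|\pmod 2$. A symbol $\ell\in[k]$ is forced if $n\mid\rho_\ell$ and free if $n\nmid\rho_\ell$. For $K\subseteq[k]$ and $i\in[r]$, $\eta_K(i)$ is the number of free symbols $\ell\in K$ with $|M_\ell^i|<\lceil\rho_\ell/n\rceil$. For $I\subseteq[r]$ and $\ell\in[k]$, $\eta_I(\ell)$ is the number of rows $i\in I$ with $|M_\ell^i|<\lceil\rho_\ell/n\rceil$ if $\ell$ is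 free, and $\eta_I(\ell)=0$ if $\ell$ is forced. *)

theory Defs
  imports Complex_Main "HOL-Number_Theory.Cong"
begin

text \<open>
  An \<open>s \<times> s\<close> array is a function of a row index and a column index, of which only the
  values on \<open>{1..s} \<times> {1..s}\<close> matter; the size \<open>s\<close> is passed explicitly. Symbols are
  natural numbers, and vectors indexed by \<open>[k]\<close> are functions restricted to \<open>{1..k}\<close>.
  Quantities that involve a difference are stated over \<^typ>\<open>int\<close>.
\<close>

type_synonym array = "nat \<Rightarrow> nat \<Rightarrow> nat"

definition occ :: "nat \<Rightarrow> array \<Rightarrow> nat \<Rightarrow> nat" where
  "occ s A l = card {(i, j). i \<in> {1..s} \<and> j \<in> {1..s} \<and> A i j = l}"

definition row_occ :: "nat \<Rightarrow> array \<Rightarrow> nat \<Rightarrow> nat \<Rightarrow> nat" where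
  "row_occ s A l i = card {j \<in> {1..s}. A i j = l}"

definition col_occ :: "nat \<Rightarrow> array \<Rightarrow> nat \<Rightarrow> nat \<Rightarrow> nat" where
  "col_occ s A l j = card {i \<in> {1..s}. A i j = l}"

definition symbols_from :: "nat \<Rightarrow> nat \<Rightarrow> array \<Rightarrow> bool" where
  "symbols_from s k A \<longleftrightarrow> (\<forall>i\<in>{1..s}. \<forall>j\<in>{1..s}. A i j \<in> {1..k})"

definition equitable_latin_rectangle ::
  "nat \<Rightarrow> nat \<Rightarrow> (nat \<Rightarrow> nat) \<Rightarrow> nat \<Rightarrow> array \<Rightarrow> bool" where
  "equitable_latin_rectangle n k \<rho> r M \<longleftrightarrow>
     symbols_from r k M \<and>
     (\<forall>l\<in>{1..k}. occ r M l \<le> \<rho> l) \<and>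
     (\<forall>l\<in>{1..k}. \<forall>i\<in>{1..r}.
        int (row_occ r M l i) \<le> \<lceil>real (\<rho> l) / real n\<rceil> \<and>
        int (col_occ r M l i) \<le> \<lceil>real (\<rho> l) / real n\<rceil>)"

definition equitable_latin_square ::
  "nat \<Rightarrow> nat \<Rightarrow> (nat \<Rightarrow> nat) \<Rightarrow> array \<Rightarrow> bool" where
  "equitable_latin_square n k \<rho> N \<longleftrightarrow>
     symbols_from n k N \<and>
     (\<forall>l\<in>{1..k}. occ n N l = \<rho> l) \<and>
     (\<forall>l\<in>{1..k}. \<forall>i\<in>{1..n}.
        \<lfloor>real (\<rho> l) / real n\<rfloor> \<le> int (row_occ n N l i) \<and>
        int (row_occ n N l i) \<le> \<lceil>real (\<rho> l) / real n\<rceil> \<and>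
        \<lfloor>real (\<rho> l) / real n\<rfloor> \<le> int (col_occ n N l i) \<and>
        int (col_occ n N l i) \<le> \<lceil>real (\<rho> l) / real n\<rceil>)"

definition externally_symmetric :: "nat \<Rightarrow> nat \<Rightarrow> array \<Rightarrow> bool" where
  "externally_symmetric k r M \<longleftrightarrow>
     (\<forall>i\<in>{1..r}. \<forall>l\<in>{1..k}. row_occ r M l i = col_occ r M l i)"

definition array_extends :: "nat \<Rightarrow> array \<Rightarrow> array \<Rightarrow> bool" where
  "array_extends r M N \<longleftrightarrow> (\<forall>i\<in>{1..r}. \<forall>j\<in>{1..r}. N i j = M i j)"

text \<open>
  With \<open>N\<close> divided into blocks \<open>M\<close>, \<open>A\<close>, \<open>B\<close>, \<open>C\<close>, the first conjunct says that \<open>B\<close> is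
  the transpose of \<open>A\<close>, and the second that \<open>C\<close> is symmetric.
\<close>

definition symmetric_off :: "nat \<Rightarrow> nat \<Rightarrow> array \<Rightarrow> bool" where
  "symmetric_off n r N \<longleftrightarrow>
     (\<forall>i\<in>{r+1..n}. \<forall>j\<in>{1..r}. N i j = N j i) \<and>
     (\<forall>i\<in>{r+1..n}. \<forall>j\<in>{r+1..n}. N i j = N j i)"

definition has_diagonal_tail ::
  "nat \<Rightarrow> nat \<Rightarrow> nat \<Rightarrow> (nat \<Rightarrow> nat) \<Rightarrow> array \<Rightarrow> bool" where
  "has_diagonal_tail n k r d N \<longleftrightarrow>
     (\<forall>l\<in>{1..k}. d l \<le> card {i \<in> {r+1..n}. N i i = l})"

definition equitably_admissible ::
  "nat \<Rightarrow> nat \<Rightarrow> (nat \<Rightarrow> nat) \<Rightarrow> (nat \<Rightarrow> nat) \<Rightarrow> nat \<Rightarrow> array \<Rightarrow> bool" where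
  "equitably_admissible n k \<rho> d r M \<longleftrightarrow>
     (\<forall>l\<in>{1..k}. occ r M l + d l \<le> \<rho> l) \<and>
     (\<forall>l\<in>{1..k}.
        (int n - int r) * \<lfloor>real (\<rho> l) / real n\<rfloor> \<le> int (\<rho> l) - int (occ r M l) \<and>
        int (\<rho> l) - int (occ r M l)
          \<le> 2 * (int n - int r) * \<lceil>real (\<rho> l) / real n\<rceil> - int (d l)) \<and>
     int (card {l \<in> {1..k}. \<not> [int (\<rho> l) - int (occ r M l) - int (d l) = 0] (mod 2)})
       \<le> int n - int r - (\<Sum>l\<in>{1..k}. int (d l)) \<and>
     [int n - int r - (\<Sum>l\<in>{1..k}. int (d l))
       = int (card {l \<in> {1..k}. odd (int (\<rho> l) - int (occ r M l) - int (d l))})] (mod 2)"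

definition free_symbol :: "nat \<Rightarrow> (nat \<Rightarrow> nat) \<Rightarrow> nat \<Rightarrow> bool" where
  "free_symbol n \<rho> l \<longleftrightarrow> \<not> n dvd \<rho> l"

definition eta_symbols ::
  "nat \<Rightarrow> (nat \<Rightarrow> nat) \<Rightarrow> nat \<Rightarrow> array \<Rightarrow> nat set \<Rightarrow> nat \<Rightarrow> nat" where
  "eta_symbols n \<rho> r M K i =
     card {l \<in> K. free_symbol n \<rho> l \<and> int (row_occ r M l i) < \<lceil>real (\<rho> l) / real n\<rceil>}"

definition eta_rows ::
  "nat \<Rightarrow> (nat \<Rightarrow> nat) \<Rightarrow> nat \<Rightarrow> array \<Rightarrow> nat set \<Rightarrow> nat \<Rightarrow> nat" where
  "eta_rows n \<rho> r M I l =
     (if free_symbol n \<rho> l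
      then card {i \<in> I. int (row_occ r M l i) < \<lceil>real (\<rho> l) / real n\<rceil>}
      else 0)"

end

theory Submission
  imports Defs
begin

text \<open>
  Since every row count of the square is a floor or a ceiling, the extension is governed by the
  0/1 deficiencies \<open>x i l\<close> = ceiling minus the count of \<open>l\<close> in row \<open>i \<le> r\<close>. Row sums fix
  the degrees of \<open>x\<close> at the rows, and the counts left for the last \<open>n - r\<close> rows and for the
  symmetric block bound its degrees at the symbols from both sides; conditions 1 and 2 are exactly the
  Hall-type criteria for such a bipartite graph. Conversely, given \<open>x\<close>, amalgamate the last
  \<open>n - r\<close> indices into one and split them off one at a time. Each splitting takes, out of what is
  left, a \<open>1/w\<close> share rounded to integers simultaneously in all entries and all line sums,
  and this rounding is again an instance of the bipartite degree theorem.
\<close>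

text \<open>Fix a symbol \<open>l\<close>, let \<open>c\<close> and \<open>f\<close> be the ceiling
  and the floor of \<open>\<rho> l / n\<close>, and let \<open>X\<close> be its total deficiency
  over rows \<open>1..r\<close>. The top right block holds \<open>r * c - |M_l| - X\<close> copies
  of \<open>l\<close>, and so does its mirror image, so \<open>X\<close> determines what is left for
  the symmetric block and for the last \<open>n - r\<close> rows. At least \<open>d l\<close> copies
  in the symmetric block and an average between \<open>f\<close> and \<open>c\<close> in the last
  rows are linear constraints on \<open>X\<close>: they are the two nontrivial lower bounds in
  condition 2 and the upper bound \<open>n * c - \<rho> l\<close> in condition 1. Forced symbols
  admit no deficiency; for them admissibility itself must supply the room for \<open>d l\<close>.

  The obstacle in the degree theorem is that the two Hall-type criteria by themselves give two
  different graphs. Alternating paths merge them, because an augmentation lowers no degree.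

  Parity enters through the symmetric block, whose off-diagonal cells come in equal pairs; (c) and
  (d) of admissibility say that the diagonal can absorb the odd remainders.\<close>

section \<open>Bipartite subgraphs with prescribed degrees, by alternating paths\<close>

text \<open>
  Alternating paths for \<open>F \<subseteq> E\<close> from a row to a column. The set \<open>A\<close> of columns still
  allowed shrinks along the path, so that no column is visited twice.
\<close>

inductive aug_path :: "('a \<times> 'b) set \<Rightarrow> ('a \<times> 'b) set \<Rightarrow> 'b set \<Rightarrow> 'a \<Rightarrow> 'b \<Rightarrow> bool" for E F where
  last: "(i, t) \<in> E - F \<Longrightarrow> t \<in> A \<Longrightarrow> aug_path E F A i t"
| step: "(i, l) \<in> E - F \<Longrightarrow> l \<in> A \<Longrightarrow> l \<noteq> t \<Longrightarrow> (i', l) \<in> F \<Longrightarrow> aug_path E F (A - {l}) i' t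
    \<Longrightarrow> aug_path E F A i t"

lemma aug_path_mono: "aug_path E F A i t \<Longrightarrow> A \<subseteq> B \<Longrightarrow> aug_path E F B i t"
proof (induction arbitrary: B rule: aug_path.induct)
  case (last i t A)
  then show ?case by (auto intro: aug_path.last)
next
  case (step i l A t i')
  have "aug_path E F (B - {l}) i' t"
    using step.prems by (intro step.IH) auto
  then show ?case using step.hyps step.prems by (blast intro: aug_path.step)
qed

text \<open>Cut the path where it visits \<open>l\<close>: it leaves \<open>l\<close> through an
  edge of \<open>F\<close>, and since columns are never repeated, the rest avoids
  \<open>l\<close>.\<close>

lemma aug_path_avoid:
  "aug_path E F A i t \<Longrightarrow> l \<noteq> t \<Longrightarrow>
    aug_path E F (A - {l}) i t \<or> (\<exists>i'. (i', l) \<in> F \<and> aug_path E F (A - {l}) i' t)"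
proof (induction rule: aug_path.induct)
  case (last i t A)
  then show ?case by (auto intro: aug_path.last)
next
  case (step i m A t i')
  show ?case
  proof (cases "m = l")
    case True
    then show ?thesis using step.hyps by blast
  next
    case False
    have sub: "A - {m} - {l} \<subseteq> A - {l}" "A - {m} - {l} = A - {l} - {m}" by auto
    from step.IH[OF step.prems] show ?thesis
    proof
      assume "aug_path E F (A - {m} - {l}) i' t"
      then have "aug_path E F (A - {l}) i t"
        using step.hyps False sub by (intro aug_path.step[of i m E F "A - {l}" t i']) auto
      then show ?thesis ..
    next
      assume "\<exists>i''. (i'', l) \<in> F \<and> aug_path E F (A - {m} - {l}) i'' t"
      then show ?thesis using aug_path_mono[of E F] sub(1) by blast
    qed
  qed
qed

text \<open>Prepending keeps columns distinct after a shortcut: if the new first column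
  \<open>l\<close> recurs, the part between its two visits is skipped. This lets reachability pass
  from one row to another.\<close>

lemma aug_path_Cons:
  assumes "(i, l) \<in> E - F" "l \<in> A" "(i', l) \<in> F" "aug_path E F A i' t" "t \<in> A"
  shows "aug_path E F A i t"
proof (cases "l = t")
  case True
  then show ?thesis using assms by (auto intro: aug_path.last)
next
  case False
  from aug_path_avoid[OF assms(4) False] assms(3)
  obtain i'' where "(i'', l) \<in> F" "aug_path E F (A - {l}) i'' t" by blast
  then show ?thesis using assms(1,2) False by (blast intro: aug_path.step)
qed

text \<open>Flipping edges changes the columns already passed. The induction therefore runs over a
  graph \<open>G\<close> that need agree with \<open>F\<close> only on the columns of
  \<open>A\<close>, the ones the rest of the path can use.\<close>

lemma aug_path_augment:
  assumes "aug_path E F A i t" "finite E"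
    and "G \<subseteq> E" "\<And>j l. l \<in> A \<Longrightarrow> (j, l) \<in> G \<longleftrightarrow> (j, l) \<in> F"
  shows "\<exists>H\<subseteq>E. (\<forall>j. card (H `` {j}) = card (G `` {j}) + of_bool (j = i)) \<and>
               (\<forall>l. card (H\<inverse> `` {l}) = card (G\<inverse> `` {l}) + of_bool (l = t))"
  using assms
proof (induction arbitrary: G rule: aug_path.induct)
  case (last i t A)
  have fin: "finite G" using finite_subset last.prems(1,2) by blast
  then have fin': "finite (G `` {j})" "finite (G\<inverse> `` {l})" for j l
    by (simp_all add: finite_Image)
  have mem: "(i, t) \<in> E - G" using last.hyps last.prems(3)[of t i] by blast
  have "card (insert (i, t) G `` {j}) = card (G `` {j}) + of_bool (j = i)" for j
  proof (cases "j = i")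
    case True
    have "insert (i, t) G `` {i} = insert t (G `` {i})" by auto
    moreover have "t \<notin> G `` {i}" using mem by auto
    ultimately show ?thesis using fin' True by simp
  next
    case False
    then have "insert (i, t) G `` {j} = G `` {j}" by auto
    then show ?thesis using False by simp
  qed
  moreover have "card ((insert (i, t) G)\<inverse> `` {l}) = card (G\<inverse> `` {l}) + of_bool (l = t)" for l
  proof (cases "l = t")
    case True
    have "(insert (i, t) G)\<inverse> `` {t} = insert i (G\<inverse> `` {t})" by auto
    moreover have "i \<notin> G\<inverse> `` {t}" using mem by auto
    ultimately show ?thesis using fin' True by simp
  next
    case False
    then have "(insert (i, t) G)\<inverse> `` {l} = G\<inverse> `` {l}" by auto
    then show ?thesis using False by simp
  qed
  moreover have "insert (i, t) G \<subseteq> E" using last.prems(2) mem by auto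
  ultimately show ?case by (intro exI[of _ "insert (i, t) G"] conjI allI)
next
  case (step i l A t i')
  \<comment> \<open>One flip hands the augmentation on: \<open>i\<close> gains an edge at
    \<open>l\<close>, \<open>i'\<close> loses its own, and column \<open>l\<close> keeps its degree.
    Row \<open>i'\<close> is one short until the induction hypothesis augments from there.\<close>
  define H where "H = insert (i, l) (G - {(i', l)})"
  have fin: "finite G" using finite_subset step.prems(1,2) by blast
  then have fin': "finite (G `` {j})" "finite (G\<inverse> `` {m})" for j m
    by (simp_all add: finite_Image)
  have mem: "(i, l) \<in> E - G" "(i', l) \<in> G"
    using step.hyps step.prems(3)[of l] by blast+
  then have ne: "i \<noteq> i'" by auto
  have row: "card (H `` {j}) + of_bool (j = i') = card (G `` {j}) + of_bool (j = i)" for j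
  proof -
    consider "j = i" | "j = i'" | "j \<noteq> i" "j \<noteq> i'" by blast
    then show ?thesis
    proof cases
      case 1
      have "H `` {i} = insert l (G `` {i})" using ne by (auto simp: H_def)
      moreover have "l \<notin> G `` {i}" using mem by auto
      ultimately show ?thesis using 1 ne fin' by simp
    next
      case 2
      have "H `` {i'} = G `` {i'} - {l}" using ne by (auto simp: H_def)
      moreover have "l \<in> G `` {i'}" using mem by auto
      ultimately show ?thesis using 2 ne fin' card_Suc_Diff1[of "G `` {i'}" l] by simp
    next
      case 3
      then have "H `` {j} = G `` {j}" by (auto simp: H_def)
      then show ?thesis using 3 by simp
    qed
  qed
  have col: "card (H\<inverse> `` {m}) = card (G\<inverse> `` {m})" for m
  proof (cases "m = l")
    case True
    have "H\<inverse> `` {l} = insert i (G\<inverse> `` {l} - {i'})" by (auto simp: H_def)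
    moreover have "i \<notin> G\<inverse> `` {l}" "i' \<in> G\<inverse> `` {l}" using mem by auto
    ultimately show ?thesis using True fin' card_Suc_Diff1[of "G\<inverse> `` {l}" i'] by simp
  next
    case False
    then have "H\<inverse> `` {m} = G\<inverse> `` {m}" by (auto simp: H_def)
    then show ?thesis by simp
  qed
  have "H \<subseteq> E" using mem step.prems(2) by (auto simp: H_def)
  moreover have "(j, m) \<in> H \<longleftrightarrow> (j, m) \<in> F" if "m \<in> A - {l}" for j m
    using that step.prems(3) by (auto simp: H_def)
  ultimately obtain H' where H': "H' \<subseteq> E"
      "\<And>j. card (H' `` {j}) = card (H `` {j}) + of_bool (j = i')"
      "\<And>m. card (H'\<inverse> `` {m}) = card (H\<inverse> `` {m}) + of_bool (m = t)"
    using step.IH[of H] step.prems(1) by blast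
  then show ?case using row col by (intro exI[of _ H']) simp
qed

text \<open>Among the subgraphs that respect the upper bounds and whose column degrees do not fall
  below those of \<open>F\<close>, one with the most edges is taken; a row of too small degree would
  contradict either maximality or \<open>hall\<close>. Taking the degrees of \<open>F\<close> as
  lower bounds is what allows lower and upper bounds to be combined afterwards.\<close>

lemma saturating_subgraph:
  fixes E :: "('a \<times> 'b) set" and s :: "'a \<Rightarrow> nat" and u :: "'b \<Rightarrow> nat"
  assumes "finite R" "finite C" and E: "E \<subseteq> R \<times> C" and F: "F \<subseteq> E"
    and F_row: "\<And>i. i \<in> R \<Longrightarrow> card (F `` {i}) \<le> s i"
    and F_col: "\<And>l. l \<in> C \<Longrightarrow> card (F\<inverse> `` {l}) \<le> u l"
    and hall: "\<And>I. I \<subseteq> R \<Longrightarrow> (\<Sum>i\<in>I. s i) \<le> (\<Sum>l\<in>C. min (u l) (card (E\<inverse> `` {l} \<inter> I)))"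
  shows "\<exists>G\<subseteq>E. (\<forall>i\<in>R. card (G `` {i}) = s i) \<and>
               (\<forall>l\<in>C. card (F\<inverse> `` {l}) \<le> card (G\<inverse> `` {l}) \<and> card (G\<inverse> `` {l}) \<le> u l)"
proof -
  define ok where "ok G \<longleftrightarrow> G \<subseteq> E \<and> (\<forall>i\<in>R. card (G `` {i}) \<le> s i) \<and>
    (\<forall>l\<in>C. card (F\<inverse> `` {l}) \<le> card (G\<inverse> `` {l}) \<and> card (G\<inverse> `` {l}) \<le> u l)" for G
  have finE: "finite E" using assms finite_subset by blast
  have fin: "finite {G. ok G}"
    by (rule finite_subset[of _ "Pow E"]) (auto simp: ok_def finE)
  have "ok F" using F F_row F_col by (auto simp: ok_def)
  define size where "size G = (\<Sum>i\<in>R. card (G `` {i}))" for G :: "('a \<times> 'b) set"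
  obtain G where G: "ok G" and max: "\<And>H. ok H \<Longrightarrow> size H \<le> size G"
    using \<open>ok F\<close> fin Max_in[of "size ` {G. ok G}"] Max_ge[of "size ` {G. ok G}"]
    by (smt (verit) empty_iff finite_imageI image_iff mem_Collect_eq)
  have GE: "G \<subseteq> E" and row: "\<And>i. i \<in> R \<Longrightarrow> card (G `` {i}) \<le> s i"
    and col: "\<And>l. l \<in> C \<Longrightarrow> card (G\<inverse> `` {l}) \<le> u l"
    using G by (auto simp: ok_def)
  \<comment> \<open>Rows that reach no unsaturated column form a set on which the hypothesis \<open>hall\<close> is tight.\<close>
  define good where "good i \<longleftrightarrow> (\<exists>t\<in>C. card (G\<inverse> `` {t}) < u t \<and> aug_path E G C i t)" for i
  define I where "I = {i \<in> R. \<not> good i}"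
  have not_good: "\<not> good i" if "i \<in> R" "card (G `` {i}) < s i" for i
  proof
    assume "good i"
    then obtain t where t: "t \<in> C" "card (G\<inverse> `` {t}) < u t" "aug_path E G C i t"
      by (auto simp: good_def)
    obtain H where H: "H \<subseteq> E"
      "\<And>j. card (H `` {j}) = card (G `` {j}) + of_bool (j = i)"
      "\<And>l. card (H\<inverse> `` {l}) = card (G\<inverse> `` {l}) + of_bool (l = t)"
      using aug_path_augment[OF t(3) finE GE] by blast
    have "ok H" using H G t that by (auto simp: ok_def)
    moreover have "size H = size G + 1"
      using that(1) \<open>finite R\<close> by (simp add: size_def H(2) sum.distrib)
    ultimately show False using max by fastforce
  qed
  have fin_col: "finite (G\<inverse> `` {l})" "finite (E\<inverse> `` {l})" for l
    using finE GE finite_subset by (blast intro: finite_Image)+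
  \<comment> \<open>If an edge from a row of \<open>I\<close> to \<open>l\<close> is missing in
    \<open>G\<close>, then \<open>l\<close> is saturated, as otherwise this edge alone would be an
    augmenting path. Moreover a good \<open>G\<close>-neighbour of \<open>l\<close> would make that
    row of \<open>I\<close> good as well.\<close>
  have tight: "min (u l) (card (E\<inverse> `` {l} \<inter> I)) \<le> card (G\<inverse> `` {l} \<inter> I)" if "l \<in> C" for l
  proof (cases "\<exists>i\<in>I. (i, l) \<in> E - G")
    case True
    then obtain i where i: "i \<in> I" "(i, l) \<in> E - G" by blast
    have "\<not> card (G\<inverse> `` {l}) < u l"
      using i that aug_path.last[OF i(2) that] by (auto simp: I_def good_def)
    moreover have "G\<inverse> `` {l} \<subseteq> I"
    proof
      fix j assume "j \<in> G\<inverse> `` {l}"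
      then have j: "(j, l) \<in> G" by auto
      have "good i" if "good j"
        using that aug_path_Cons[OF i(2) \<open>l \<in> C\<close> j] by (auto simp: good_def)
      then show "j \<in> I" using i j GE E by (auto simp: I_def)
    qed
    ultimately show ?thesis by (simp add: Int_absorb2)
  next
    case False
    then have "E\<inverse> `` {l} \<inter> I \<subseteq> G\<inverse> `` {l} \<inter> I" by auto
    then show ?thesis using fin_col by (meson card_mono finite_Int min.coboundedI2)
  qed
  have finI: "finite I" using \<open>finite R\<close> by (simp add: I_def)
  have count: "(\<Sum>i\<in>I. card (G `` {i})) = (\<Sum>l\<in>C. card (G\<inverse> `` {l} \<inter> I))"
  proof -
    have "(\<Sum>i\<in>I. card (G `` {i})) = (\<Sum>i\<in>I. \<Sum>l\<in>C. of_bool ((i, l) \<in> G))"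
    proof (rule sum.cong[OF refl])
      fix i assume "i \<in> I"
      have "G `` {i} = {l \<in> C. (i, l) \<in> G}" using GE E by auto
      then show "card (G `` {i}) = (\<Sum>l\<in>C. of_bool ((i, l) \<in> G))"
        using \<open>finite C\<close> by (simp add: Int_def)
    qed
    also have "\<dots> = (\<Sum>l\<in>C. \<Sum>i\<in>I. of_bool ((i, l) \<in> G))"
      by (rule sum.swap)
    also have "\<dots> = (\<Sum>l\<in>C. card (G\<inverse> `` {l} \<inter> I))"
    proof (rule sum.cong[OF refl])
      fix l assume "l \<in> C"
      have "G\<inverse> `` {l} \<inter> I = {i \<in> I. (i, l) \<in> G}" by auto
      then show "(\<Sum>i\<in>I. of_bool ((i, l) \<in> G)) = card (G\<inverse> `` {l} \<inter> I)"
        using finI by (simp add: Int_def)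
    qed
    finally show ?thesis .
  qed
  \<comment> \<open>No row exceeds its demand, so this inequality leaves no row of \<open>I\<close>
    deficient; and deficient rows all lie in \<open>I\<close>.\<close>
  have "(\<Sum>i\<in>I. s i) \<le> (\<Sum>i\<in>I. card (G `` {i}))"
    using hall[of I] sum_mono[of C, OF tight] unfolding count by (force simp: I_def)
  then have "card (G `` {i}) = s i" if "i \<in> R" for i
  proof -
    have "\<not> card (G `` {i}) < s i"
    proof
      assume less: "card (G `` {i}) < s i"
      then have "i \<in> I" using not_good that by (simp add: I_def)
      then have "(\<Sum>i\<in>I. card (G `` {i})) < (\<Sum>i\<in>I. s i)"
        using less row finI by (intro sum_strict_mono_ex1) (auto simp: I_def)
      then show False using \<open>(\<Sum>i\<in>I. s i) \<le> _\<close> by simp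
    qed
    then show ?thesis using row[OF that] by simp
  qed
  then show ?thesis using G by (auto simp: ok_def)
qed

text \<open>A merging of the kind of Mendelsohn and Dulmage, in two passes. With the roles of rows
  and columns exchanged and starting from the empty graph, the first pass gives every column exactly
  \<open>lo\<close> edges within the row bounds \<open>s\<close>. The second starts from that graph
  and fills the rows without lowering a column degree.\<close>

theorem degree_interval_subgraph:
  fixes E :: "('a \<times> 'b) set" and s :: "'a \<Rightarrow> nat" and lo up :: "'b \<Rightarrow> nat"
  assumes "finite R" "finite C" and E: "E \<subseteq> R \<times> C"
    and lo_up: "\<And>l. l \<in> C \<Longrightarrow> lo l \<le> up l"
    and rows: "\<And>I. I \<subseteq> R \<Longrightarrow> (\<Sum>i\<in>I. s i) \<le> (\<Sum>l\<in>C. min (up l) (card (E\<inverse> `` {l} \<inter> I)))"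
    and cols: "\<And>K. K \<subseteq> C \<Longrightarrow> (\<Sum>l\<in>K. lo l) \<le> (\<Sum>i\<in>R. min (s i) (card (E `` {i} \<inter> K)))"
  shows "\<exists>G\<subseteq>E. (\<forall>i\<in>R. card (G `` {i}) = s i) \<and>
               (\<forall>l\<in>C. lo l \<le> card (G\<inverse> `` {l}) \<and> card (G\<inverse> `` {l}) \<le> up l)"
proof -
  have "\<exists>F\<subseteq>E\<inverse>. (\<forall>l\<in>C. card (F `` {l}) = lo l) \<and>
               (\<forall>i\<in>R. card ({}\<inverse> `` {i} :: 'b set) \<le> card (F\<inverse> `` {i}) \<and> card (F\<inverse> `` {i}) \<le> s i)"
  proof (rule saturating_subgraph)
    show "E\<inverse> \<subseteq> C \<times> R" using E by auto
    show "(\<Sum>l\<in>K. lo l) \<le> (\<Sum>i\<in>R. min (s i) (card ((E\<inverse>)\<inverse> `` {i} \<inter> K)))" if "K \<subseteq> C" for K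
      using cols[OF that] by simp
  qed (use assms(1,2) in simp_all)
  then obtain F where F: "F \<subseteq> E\<inverse>" "\<And>l. l \<in> C \<Longrightarrow> card (F `` {l}) = lo l"
    "\<And>i. i \<in> R \<Longrightarrow> card (F\<inverse> `` {i}) \<le> s i" by auto
  have "\<exists>G\<subseteq>E. (\<forall>i\<in>R. card (G `` {i}) = s i) \<and>
     (\<forall>l\<in>C. card ((F\<inverse>)\<inverse> `` {l}) \<le> card (G\<inverse> `` {l}) \<and> card (G\<inverse> `` {l}) \<le> up l)"
  proof (rule saturating_subgraph[OF assms(1,2) E _ F(3) _ rows])
    show "F\<inverse> \<subseteq> E" using F(1) by auto
    show "card ((F\<inverse>)\<inverse> `` {l}) \<le> up l" if "l \<in> C" for l
      using lo_up[OF that] F(2)[OF that] by simp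
  qed
  then show ?thesis using F(2) by simp
qed

section \<open>Rounding a matrix together with its line sums\<close>

text \<open>For positive \<open>w\<close> this is \<open>|y - b / w| < 1\<close> with denominators
  cleared: \<open>y\<close> is the floor or the ceiling of \<open>b / w\<close>.\<close>

definition rounding :: "nat \<Rightarrow> nat \<Rightarrow> nat \<Rightarrow> bool" where
  "rounding w b y \<longleftrightarrow> w * y < b + w \<and> b < w * y + w"

lemma rounding_div_bounds:
  assumes "0 < w" "b div w \<le> y" "y \<le> (b + w - 1) div w"
  shows "rounding w b y"
proof -
  have "w * y \<le> w * ((b + w - 1) div w)" using assms by simp
  also have "\<dots> \<le> b + w - 1" by simp
  finally have "w * y < b + w" using assms(1) by linarith
  moreover have "b < w * (b div w) + w" using dividend_less_times_div[OF assms(1), of b] by simp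
  moreover have "w * (b div w) \<le> w * y" using assms by simp
  ultimately show ?thesis unfolding rounding_def by linarith
qed

lemma rounding_add_mult: "rounding w (b + w * a) (y + a) \<longleftrightarrow> rounding w b y"
  by (simp add: rounding_def algebra_simps)

lemma rounding_le:
  assumes "rounding w b y"
  shows "y \<le> b"
proof (rule ccontr)
  assume "\<not> y \<le> b"
  then have "w * (b + 1) \<le> w * y" by (intro mult_le_mono) auto
  moreover have "0 < w" using assms by (auto simp: rounding_def)
  then have "b \<le> w * b" by simp
  ultimately show False using assms unfolding rounding_def distrib_left by linarith
qed

text \<open>For \<open>w\<close> at least 2, \<open>2 * g / w\<close> is at most the integer
  \<open>g\<close>, hence so is its ceiling. This guarantees that splitting off an index never uses
  more pairs than there are.\<close>

lemma rounding_double_le: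
  assumes "rounding w (2 * g) y" "2 \<le> w"
  shows "y \<le> g"
proof (rule ccontr)
  assume "\<not> y \<le> g"
  then have "w * (g + 1) \<le> w * y" by (intro mult_le_mono) auto
  moreover have "2 * g \<le> w * g" using assms(2) by simp
  ultimately show False using assms(1) unfolding rounding_def distrib_left by linarith
qed

text \<open>The average \<open>(D + y) / (w + 1)\<close> lies between the integers \<open>lo\<close>
  and \<open>hi\<close>, so its rounding \<open>y\<close> does too. If \<open>y = lo\<close>,
  removing it leaves at least \<open>w * lo\<close>. If \<open>y = lo + 1\<close>, the average was
  strictly above \<open>lo\<close>, and the surplus of at least one pays for the extra unit. The
  upper bound is dual.\<close>

lemma rounding_split_bounds:
  assumes "rounding (Suc w) (D + y) y" "Suc w * lo \<le> D + y" "D + y \<le> Suc w * hi" "hi \<le> Suc lo"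
  shows "lo \<le> y" "y \<le> hi" "w * lo \<le> D" "D \<le> w * hi"
proof -
  have r: "Suc w * y < D + y + Suc w" "D + y < Suc w * y + Suc w"
    using assms(1) by (auto simp: rounding_def)
  have "Suc w * lo < Suc w * Suc y" using r(2) assms(2) by simp
  then show lo: "lo \<le> y" by (metis mult_less_cancel1 less_Suc_eq_le)
  have "Suc w * y < Suc w * Suc hi" using r(1) assms(3) by simp
  then show hi: "y \<le> hi" by (metis mult_less_cancel1 less_Suc_eq_le)
  consider "y = lo" | "y = Suc lo" "hi = Suc lo" using lo hi assms(4) by linarith
  then show "w * lo \<le> D"
    by cases (use assms(2) r in auto)
  consider "y = hi" | "hi = Suc y" using lo hi assms(4) by linarith
  then show "D \<le> w * hi"
    by cases (use assms(3) r in auto)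
qed

text \<open>The fractional parts of \<open>B i l / w\<close>, taken as edge weights, are a
  fractional subgraph with the wanted degrees. Double counting these weights yields both Hall-type
  criteria, and the degree theorem replaces the weights by 0 and 1.\<close>

theorem matrix_rounding:
  fixes B :: "'a \<Rightarrow> 'b \<Rightarrow> nat"
  assumes "finite J" "finite C" "0 < w"
    and row: "\<And>i. i \<in> J \<Longrightarrow> (\<Sum>l\<in>C. B i l) = w * s i"
  shows "\<exists>y. (\<forall>i\<in>J. \<forall>l\<in>C. rounding w (B i l) (y i l)) \<and>
             (\<forall>i\<in>J. (\<Sum>l\<in>C. y i l) = s i) \<and>
             (\<forall>l\<in>C. rounding w (\<Sum>i\<in>J. B i l) (\<Sum>i\<in>J. y i l))"
proof -
  define f where "f i l = B i l mod w" for i l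
  define q where "q i l = B i l div w" for i l
  have B: "B i l = f i l + w * q i l" for i l by (simp add: f_def q_def)
  \<comment> \<open>Integral entries are excluded because rounding must not move them; every other
    entry may go either way.\<close>
  define E where "E = {(i, l). i \<in> J \<and> l \<in> C \<and> f i l \<noteq> 0}"
  \<comment> \<open>How many entries of row \<open>i\<close> are rounded up; by \<open>q_le\<close>
    the subtraction does not truncate.\<close>
  define s' where "s' i = s i - (\<Sum>l\<in>C. q i l)" for i
  define D where "D l = (\<Sum>i\<in>J. f i l)" for l
  define up where "up l = (D l + w - 1) div w" for l
  have f_less: "f i l < w" for i l using assms(3) by (simp add: f_def)
  then have f_le: "f i l \<le> w" for i l by (simp add: less_imp_le)
  have row_q: "w * s i = (\<Sum>l\<in>C. f i l) + w * (\<Sum>l\<in>C. q i l)" if "i \<in> J" for i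
    using row[OF that] by (simp add: B sum.distrib sum_distrib_left)
  then have row_f: "(\<Sum>l\<in>C. f i l) = w * s' i" if "i \<in> J" for i
    using that by (simp add: s'_def diff_mult_distrib2)
  have q_le: "(\<Sum>l\<in>C. q i l) \<le> s i" if "i \<in> J" for i
  proof -
    have "w * (\<Sum>l\<in>C. q i l) \<le> w * s i" using row_q[OF that] by simp
    then show ?thesis using assms(3) by simp
  qed
  have up: "D l \<le> w * up l" for l
  proof -
    have "D l + w - 1 < w * up l + w"
      using dividend_less_times_div[OF assms(3), of "D l + w - 1"] by (simp add: up_def)
    then show ?thesis using assms(3) by linarith
  qed
  have sum_f_le_card: "(\<Sum>i\<in>I. g i) \<le> w * card A"
    if "finite I" "A \<subseteq> I" "\<And>i. i \<in> I \<Longrightarrow> g i \<le> w" "\<And>i. i \<in> I - A \<Longrightarrow> g i = 0"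
    for g :: "'c \<Rightarrow> nat" and I A
  proof -
    have "(\<Sum>i\<in>I. g i) = (\<Sum>i\<in>A. g i)"
      using that by (intro sum.mono_neutral_right) auto
    also have "\<dots> \<le> (\<Sum>i\<in>A. w)" using that by (intro sum_mono) auto
    finally show ?thesis by (simp add: mult.commute)
  qed
  have min_mult: "x \<le> w * min a b" if "x \<le> w * a" "x \<le> w * b" for x a b
    using that by (simp add: min_def)
  have "\<exists>G\<subseteq>E. (\<forall>i\<in>J. card (G `` {i}) = s' i) \<and>
               (\<forall>l\<in>C. D l div w \<le> card (G\<inverse> `` {l}) \<and> card (G\<inverse> `` {l}) \<le> up l)"
  proof (rule degree_interval_subgraph[OF assms(1,2)])
    show "E \<subseteq> J \<times> C" by (auto simp: E_def)
    show "D l div w \<le> up l" for l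
      unfolding up_def using assms(3) by (intro div_le_mono) simp
  next
    fix I assume I: "I \<subseteq> J"
    then have finI: "finite I" using assms(1) finite_subset by blast
    have "w * (\<Sum>i\<in>I. s' i) = (\<Sum>i\<in>I. \<Sum>l\<in>C. f i l)"
      unfolding sum_distrib_left using I row_f by (intro sum.cong) auto
    also have "\<dots> = (\<Sum>l\<in>C. \<Sum>i\<in>I. f i l)" by (rule sum.swap)
    also have "\<dots> \<le> (\<Sum>l\<in>C. w * min (up l) (card (E\<inverse> `` {l} \<inter> I)))"
    proof (intro sum_mono min_mult)
      fix l assume l: "l \<in> C"
      have "(\<Sum>i\<in>I. f i l) \<le> D l" unfolding D_def using I assms(1) by (intro sum_mono2) auto
      then show "(\<Sum>i\<in>I. f i l) \<le> w * up l" using up order_trans by blast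
      show "(\<Sum>i\<in>I. f i l) \<le> w * card (E\<inverse> `` {l} \<inter> I)"
        by (rule sum_f_le_card[OF finI]) (use f_le I l in \<open>auto simp: E_def\<close>)
    qed
    finally show "(\<Sum>i\<in>I. s' i) \<le> (\<Sum>l\<in>C. min (up l) (card (E\<inverse> `` {l} \<inter> I)))"
      using assms(3) by (simp flip: sum_distrib_left)
  next
    fix K assume K: "K \<subseteq> C"
    then have finK: "finite K" using assms(2) finite_subset by blast
    have "w * (\<Sum>l\<in>K. D l div w) \<le> (\<Sum>l\<in>K. \<Sum>i\<in>J. f i l)"
      unfolding sum_distrib_left by (intro sum_mono) (simp flip: D_def)
    also have "\<dots> = (\<Sum>i\<in>J. \<Sum>l\<in>K. f i l)" by (rule sum.swap)
    also have "\<dots> \<le> (\<Sum>i\<in>J. w * min (s' i) (card (E `` {i} \<inter> K)))"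
    proof (intro sum_mono min_mult)
      fix i assume i: "i \<in> J"
      have "(\<Sum>l\<in>K. f i l) \<le> (\<Sum>l\<in>C. f i l)" using K assms(2) by (intro sum_mono2) auto
      then show "(\<Sum>l\<in>K. f i l) \<le> w * s' i" using row_f[OF i] by simp
      show "(\<Sum>l\<in>K. f i l) \<le> w * card (E `` {i} \<inter> K)"
        by (rule sum_f_le_card[OF finK]) (use f_le K i in \<open>auto simp: E_def\<close>)
    qed
    finally show "(\<Sum>l\<in>K. D l div w) \<le> (\<Sum>i\<in>J. min (s' i) (card (E `` {i} \<inter> K)))"
      using assms(3) by (simp flip: sum_distrib_left)
  qed
  then obtain G where G: "G \<subseteq> E" "\<And>i. i \<in> J \<Longrightarrow> card (G `` {i}) = s' i"
    "\<And>l. l \<in> C \<Longrightarrow> D l div w \<le> card (G\<inverse> `` {l})" "\<And>l. l \<in> C \<Longrightarrow> card (G\<inverse> `` {l}) \<le> up l"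
    by blast
  define y where "y i l = of_bool ((i, l) \<in> G) + q i l" for i l
  show ?thesis
  proof (intro exI[of _ y] conjI ballI)
    fix i l assume il: "i \<in> J" "l \<in> C"
    have "rounding w (f i l) (of_bool ((i, l) \<in> G))"
      using G(1) assms(3) f_less[of i l] by (auto simp: rounding_def E_def)
    then show "rounding w (B i l) (y i l)"
      unfolding y_def B by (simp add: rounding_add_mult)
  next
    fix i assume i: "i \<in> J"
    have "(\<Sum>l\<in>C. of_bool ((i, l) \<in> G)) = card (G `` {i})"
    proof -
      have "G `` {i} = {l \<in> C. (i, l) \<in> G}" using G(1) by (auto simp: E_def)
      then show ?thesis using assms(2) by (simp add: Int_def)
    qed
    then show "(\<Sum>l\<in>C. y i l) = s i"
      using G(2)[OF i] q_le[OF i] by (simp add: y_def sum.distrib s'_def)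
  next
    fix l assume l: "l \<in> C"
    have "(\<Sum>i\<in>J. of_bool ((i, l) \<in> G)) = card (G\<inverse> `` {l})"
    proof -
      have "G\<inverse> `` {l} = {i \<in> J. (i, l) \<in> G}" using G(1) by (auto simp: E_def)
      then show ?thesis using assms(1) by (simp add: Int_def)
    qed
    then have "(\<Sum>i\<in>J. y i l) = card (G\<inverse> `` {l}) + (\<Sum>i\<in>J. q i l)"
      by (simp add: y_def sum.distrib)
    moreover have "(\<Sum>i\<in>J. B i l) = D l + w * (\<Sum>i\<in>J. q i l)"
      by (simp add: B D_def sum.distrib sum_distrib_left)
    ultimately show "rounding w (\<Sum>i\<in>J. B i l) (\<Sum>i\<in>J. y i l)"
      using rounding_div_bounds[OF assms(3)] G(3,4)[OF l] by (simp add: rounding_add_mult up_def)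
  qed
qed

section \<open>Splitting the amalgamated indices off one by one\<close>

text \<open>
  The state of the amalgamation: rows \<open>1..r\<close> still need \<open>b i l\<close> copies of \<open>l\<close>, the
  unfinished diagonal needs \<open>e l\<close> copies, and \<open>g l\<close> is the number of unordered pairs of
  distinct unfinished indices that receive \<open>l\<close>.
\<close>

lemma symmetric_tail:
  fixes b :: "nat \<Rightarrow> nat \<Rightarrow> nat" and e g lo hi :: "nat \<Rightarrow> nat"
  assumes "finite S"
    and b: "\<And>i. i \<in> {1..r} \<Longrightarrow> (\<Sum>l\<in>S. b i l) = w"
    and e: "(\<Sum>l\<in>S. e l) = w"
    and g: "2 * (\<Sum>l\<in>S. g l) = w * (w - 1)"
    and hi_lo: "\<And>l. l \<in> S \<Longrightarrow> hi l \<le> Suc (lo l)"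
    and lo: "\<And>l. l \<in> S \<Longrightarrow> w * lo l \<le> (\<Sum>i\<in>{1..r}. b i l) + e l + 2 * g l"
    and hi: "\<And>l. l \<in> S \<Longrightarrow> (\<Sum>i\<in>{1..r}. b i l) + e l + 2 * g l \<le> w * hi l"
  shows "\<exists>T :: nat \<Rightarrow> nat \<Rightarrow> nat. (\<forall>i j. T i j = T j i) \<and>
    (\<forall>i\<in>{r+1..r+w}. \<forall>j\<in>{1..r+w}. T i j \<in> S) \<and>
    (\<forall>l\<in>S. \<forall>i\<in>{1..r}. (\<Sum>j\<in>{r+1..r+w}. of_bool (T i j = l)) = b i l) \<and>
    (\<forall>l\<in>S. \<forall>i\<in>{r+1..r+w}. lo l \<le> (\<Sum>j\<in>{1..r+w}. of_bool (T i j = l)) \<and>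
        (\<Sum>j\<in>{1..r+w}. of_bool (T i j = l)) \<le> hi l) \<and>
    (\<forall>l\<in>S. (\<Sum>i\<in>{r+1..r+w}. \<Sum>j\<in>{1..r+w}. of_bool (T i j = l)) =
        (\<Sum>i\<in>{1..r}. b i l) + e l + 2 * g l) \<and>
    (\<forall>l\<in>S. (\<Sum>i\<in>{r+1..r+w}. of_bool (T i i = l)) = e l)"
  using b e g lo hi
proof (induction w arbitrary: r b e g)
  case 0
  have "b i l = 0" if "i \<in> {1..r}" "l \<in> S" for i l
    using 0(1)[OF that(1)] that(2) \<open>finite S\<close> by simp
  moreover have "e l = 0" "g l = 0" if "l \<in> S" for l
    using 0(2,3) that \<open>finite S\<close> by simp_all
  ultimately show ?case by (intro exI[of _ "\<lambda>_ _. 0"]) simp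
next
  case (Suc w)
  define v where "v = Suc r"
  \<comment> \<open>Row \<open>0\<close> is the diagonal, rows \<open>1..r\<close> are the finished
    indices, and row \<open>v\<close> holds the pairs inside the tail. A pair counts twice, once
    from each end, so that the column sum \<open>D l\<close> is the number of cells with
    \<open>l\<close> in the unfinished rows.\<close>
  define B where "B i l = (if i = 0 then e l else if i \<le> r then b i l else 2 * g l)" for i l
  define D where "D l = (\<Sum>i\<in>{1..r}. b i l) + e l + 2 * g l" for l
  define tot where "tot y l = y 0 l + (\<Sum>i\<in>{1..r}. y i l) + y v l" for y :: "nat \<Rightarrow> nat \<Rightarrow> nat" and l
  have J: "(\<Sum>i\<in>{0..v}. y i l) = tot y l" for y :: "nat \<Rightarrow> nat \<Rightarrow> nat" and l
    by (simp add: tot_def v_def sum.atLeast_Suc_atMost[of 0 r])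
  have D_B: "D l = tot B l" for l
    by (simp add: D_def tot_def B_def v_def)
  \<comment> \<open>A share of \<open>1 / (w + 1)\<close> is integral in every row: the new index
    \<open>v\<close> has one diagonal cell, one cell against each finished index, and
    \<open>w\<close> cells against the other unfinished ones.\<close>
  have B_sum: "(\<Sum>l\<in>S. B i l) = Suc w * (if i \<le> r then 1 else w)" for i
    using Suc.prems(1)[of i] Suc.prems(2,3)
    by (cases "i = 0"; cases "i \<le> r") (simp_all add: B_def flip: sum_distrib_left)
  have "\<exists>y. (\<forall>i\<in>{0..v}. \<forall>l\<in>S. rounding (Suc w) (B i l) (y i l)) \<and>
             (\<forall>i\<in>{0..v}. (\<Sum>l\<in>S. y i l) = (if i \<le> r then 1 else w)) \<and>
             (\<forall>l\<in>S. rounding (Suc w) (\<Sum>i\<in>{0..v}. B i l) (\<Sum>i\<in>{0..v}. y i l))"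
    by (rule matrix_rounding) (use \<open>finite S\<close> B_sum in auto)
  then obtain y where y: "\<And>i l. i \<le> v \<Longrightarrow> l \<in> S \<Longrightarrow> rounding (Suc w) (B i l) (y i l)"
    and y_sum: "\<And>i. i \<le> v \<Longrightarrow> (\<Sum>l\<in>S. y i l) = (if i \<le> r then 1 else w)"
    and y_tot: "\<And>l. l \<in> S \<Longrightarrow> rounding (Suc w) (D l) (tot y l)"
    unfolding J D_B by (metis atLeastAtMost_iff zero_le)
  have y_le: "y i l \<le> B i l" if "i \<le> v" "l \<in> S" for i l
    using y[OF that] by (rule rounding_le)
  have y_b: "y i l \<le> b i l" if "i \<in> {1..r}" "l \<in> S" for i l
    using y_le[of i l] that by (simp add: B_def v_def)
  have y_e: "y 0 l \<le> e l" if "l \<in> S" for l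
    using y_le[of 0 l] that by (simp add: B_def)
  \<comment> \<open>With a single unfinished index the divisor is 1 and
    \<open>rounding_double_le\<close> does not apply, but then row \<open>v\<close> has sum
    0.\<close>
  have y_g: "y v l \<le> g l" if "l \<in> S" for l
  proof (cases "w = 0")
    case True
    then have "y v l = 0" using y_sum[of v] that \<open>finite S\<close> by (simp add: v_def)
    then show ?thesis by simp
  next
    case False
    then show ?thesis using y[of v l] that rounding_double_le by (simp add: B_def v_def)
  qed
  have "\<exists>a\<in>S. \<forall>l\<in>S. y i l = of_bool (a = l)" if "i \<le> r" for i
  proof -
    have "(\<Sum>l\<in>S. y i l) = 1" using y_sum[of i] that by (simp add: v_def)
    then obtain a where "a \<in> S" "y i a = 1" "\<forall>l\<in>S. a \<noteq> l \<longrightarrow> y i l = 0"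
      using sum_eq_1_iff[OF \<open>finite S\<close>, of "y i"] by auto
    then show ?thesis by (intro bexI[of _ a]) auto
  qed
  then obtain t where t: "\<And>i. i \<le> r \<Longrightarrow> t i \<in> S"
    and y_t: "\<And>i l. i \<le> r \<Longrightarrow> l \<in> S \<Longrightarrow> y i l = of_bool (t i = l)"
    by metis
  \<comment> \<open>The cells between \<open>v\<close> and the later indices become the demand of
    the newly finished row \<open>v\<close>. Each of them uses up one unordered pair, so
    \<open>g\<close> drops by \<open>y v l\<close>.\<close>
  define b' where "b' i l = (if i = v then y v l else b i l - y i l)" for i l
  define e' where "e' l = e l - y 0 l" for l
  define g' where "g' l = g l - y v l" for l
  define D' where "D' l = (\<Sum>i\<in>{1..v}. b' i l) + e' l + 2 * g' l" for l
  \<comment> \<open>A pair joining \<open>v\<close> to a later index costs two units of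
    \<open>2 * g\<close> and returns one as demand of row \<open>v\<close>: its cell in row
    \<open>v\<close> is filled, the mirror cell lies in a later row.\<close>
  have D': "D' l + tot y l = D l" if "l \<in> S" for l
  proof -
    have "(\<Sum>i\<in>{1..r}. b' i l) + (\<Sum>i\<in>{1..r}. y i l) = (\<Sum>i\<in>{1..r}. b i l)"
      unfolding sum.distrib[symmetric] using y_b that by (intro sum.cong) (auto simp: b'_def v_def)
    then show ?thesis
      using y_e[OF that] y_g[OF that]
      by (simp add: D'_def D_def tot_def e'_def g'_def b'_def v_def)
  qed
  have bounds: "lo l \<le> tot y l" "tot y l \<le> hi l" "w * lo l \<le> D' l" "D' l \<le> w * hi l"
    if "l \<in> S" for l
    using rounding_split_bounds[of w "D' l" "tot y l" "lo l" "hi l"] D'[OF that] y_tot[OF that]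
      Suc.prems(4,5)[OF that] hi_lo[OF that] by (simp_all add: D_def)
  have "\<exists>T :: nat \<Rightarrow> nat \<Rightarrow> nat. (\<forall>i j. T i j = T j i) \<and>
    (\<forall>i\<in>{v+1..v+w}. \<forall>j\<in>{1..v+w}. T i j \<in> S) \<and>
    (\<forall>l\<in>S. \<forall>i\<in>{1..v}. (\<Sum>j\<in>{v+1..v+w}. of_bool (T i j = l)) = b' i l) \<and>
    (\<forall>l\<in>S. \<forall>i\<in>{v+1..v+w}. lo l \<le> (\<Sum>j\<in>{1..v+w}. of_bool (T i j = l)) \<and>
        (\<Sum>j\<in>{1..v+w}. of_bool (T i j = l)) \<le> hi l) \<and>
    (\<forall>l\<in>S. (\<Sum>i\<in>{v+1..v+w}. \<Sum>j\<in>{1..v+w}. of_bool (T i j = l)) =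
        (\<Sum>i\<in>{1..v}. b' i l) + e' l + 2 * g' l) \<and>
    (\<forall>l\<in>S. (\<Sum>i\<in>{v+1..v+w}. of_bool (T i i = l)) = e' l)"
  proof (rule Suc.IH)
    fix i assume i: "i \<in> {1..v}"
    show "(\<Sum>l\<in>S. b' i l) = w"
    proof (cases "i = v")
      case True
      then show ?thesis using y_sum[of v] by (simp add: b'_def v_def)
    next
      case False
      then have i': "i \<in> {1..r}" using i by (simp add: v_def)
      then have "(\<Sum>l\<in>S. b' i l) = (\<Sum>l\<in>S. b i l) - (\<Sum>l\<in>S. y i l)"
        using False y_b by (simp add: b'_def sum_subtractf_nat)
      then show ?thesis using Suc.prems(1)[OF i'] y_sum[of i] i' by (simp add: v_def)
    qed
  next
    show "(\<Sum>l\<in>S. e' l) = w"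
      using Suc.prems(2) y_sum[of 0] y_e by (simp add: e'_def sum_subtractf_nat)
    show "2 * (\<Sum>l\<in>S. g' l) = w * (w - 1)"
    proof -
      have "(\<Sum>l\<in>S. g' l) = (\<Sum>l\<in>S. g l) - w"
        using y_sum[of v] y_g by (simp add: g'_def sum_subtractf_nat v_def)
      then have "2 * (\<Sum>l\<in>S. g' l) = Suc w * w - 2 * w"
        using Suc.prems(3) by (simp add: diff_mult_distrib2)
      also have "\<dots> = w * (w - 1)" by (cases w) auto
      finally show ?thesis .
    qed
    show "w * lo l \<le> (\<Sum>i\<in>{1..v}. b' i l) + e' l + 2 * g' l"
      "(\<Sum>i\<in>{1..v}. b' i l) + e' l + 2 * g' l \<le> w * hi l" if "l \<in> S" for l
      using bounds[OF that] by (simp_all add: D'_def)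
  qed
  then obtain T' where "\<forall>i j. T' i j = T' j i"
    "\<forall>i\<in>{v+1..v+w}. \<forall>j\<in>{1..v+w}. T' i j \<in> S"
    "\<forall>l\<in>S. \<forall>i\<in>{1..v}. (\<Sum>j\<in>{v+1..v+w}. of_bool (T' i j = l)) = b' i l"
    "\<forall>l\<in>S. \<forall>i\<in>{v+1..v+w}. lo l \<le> (\<Sum>j\<in>{1..v+w}. of_bool (T' i j = l)) \<and>
        (\<Sum>j\<in>{1..v+w}. of_bool (T' i j = l)) \<le> hi l"
    "\<forall>l\<in>S. (\<Sum>i\<in>{v+1..v+w}. \<Sum>j\<in>{1..v+w}. of_bool (T' i j = l)) = D' l"
    "\<forall>l\<in>S. (\<Sum>i\<in>{v+1..v+w}. of_bool (T' i i = l)) = e' l"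
    unfolding D'_def[symmetric] by (elim exE conjE) (rule that, assumption+)
  note T' = this[rule_format]
  \<comment> \<open>\<open>t 0\<close> fills the diagonal cell of \<open>v\<close> and
    \<open>t j\<close> its cells against a finished \<open>j\<close>; the cells against later
    indices are already in \<open>T'\<close>.\<close>
  define T where "T i j = (if i = v \<and> j = v then t 0 else if i = v \<and> j < v then t j
      else if j = v \<and> i < v then t i else T' i j)" for i j
  have T_sym: "T i j = T j i" for i j by (auto simp: T_def T'(1))
  have T_late: "T i j = T' i j" if "i > v" for i j using that by (auto simp: T_def)
  have ivl: "{r+1..r + Suc w} = insert v {v+1..v+w}" "{1..r + Suc w} = {1..v+w}"
    "{1..v+w} = insert v ({1..r} \<union> {v+1..v+w})" "{1..r} \<inter> {v+1..v+w} = {}"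
    by (auto simp: v_def)
  have row_v: "(\<Sum>j\<in>{1..v+w}. of_bool (T v j = l)) = tot y l" if l: "l \<in> S" for l
  proof -
    have "(\<Sum>j\<in>{1..v+w}. of_bool (T v j = l)) = of_bool (T v v = l) +
        ((\<Sum>j\<in>{1..r}. of_bool (T v j = l)) + (\<Sum>j\<in>{v+1..v+w}. of_bool (T v j = l)))"
      unfolding ivl(3) using ivl(4) by (subst sum.insert) (auto simp: sum.union_disjoint v_def)
    also have "of_bool (T v v = l) = y 0 l" using y_t[of 0] l by (simp add: T_def)
    also have "(\<Sum>j\<in>{1..r}. of_bool (T v j = l)) = (\<Sum>j\<in>{1..r}. y j l)"
      using y_t l by (intro sum.cong) (auto simp: T_def v_def)
    also have "(\<Sum>j\<in>{v+1..v+w}. of_bool (T v j = l)) = (\<Sum>j\<in>{v+1..v+w}. of_bool (T' v j = l))"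
      by (intro sum.cong) (auto simp: T_def)
    also have "\<dots> = y v l" using T'(3)[OF l, of v] by (simp add: b'_def v_def)
    finally show ?thesis by (simp add: tot_def)
  qed
  show ?case
  proof (intro exI[of _ T] conjI allI ballI)
    show "T i j = T j i" for i j by (rule T_sym)
  next
    fix i j assume "i \<in> {r+1..r + Suc w}" "j \<in> {1..r + Suc w}"
    then show "T i j \<in> S"
      using t T'(2)[of i j] T'(2)[of j i] unfolding ivl(1,2)
      by (auto simp: T_def v_def T'(1)[of "Suc r"])
  next
    fix l i assume l: "l \<in> S" and i: "i \<in> {1..r}"
    then have i': "i < v" "i \<in> {1..v}" by (auto simp: v_def)
    have "(\<Sum>j\<in>{r+1..r + Suc w}. of_bool (T i j = l)) =
        of_bool (T i v = l) + (\<Sum>j\<in>{v+1..v+w}. of_bool (T i j = l))"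
      unfolding ivl(1) by (subst sum.insert) auto
    also have "(\<Sum>j\<in>{v+1..v+w}. of_bool (T i j = l)) = (\<Sum>j\<in>{v+1..v+w}. of_bool (T' i j = l))"
      using i' by (intro sum.cong) (auto simp: T_def)
    also have "\<dots> = b i l - y i l" using T'(3)[OF l i'(2)] i' by (simp add: b'_def)
    also have "of_bool (T i v = l) = y i l" using y_t[of i l] l i i' by (simp add: T_def)
    finally show "(\<Sum>j\<in>{r+1..r + Suc w}. of_bool (T i j = l)) = b i l"
      using y_b[OF i l] by simp
  next
    fix l i assume l: "l \<in> S" and i: "i \<in> {r+1..r + Suc w}"
    show "lo l \<le> (\<Sum>j\<in>{1..r + Suc w}. of_bool (T i j = l))"
      using i row_v[OF l] bounds[OF l] T'(4)[OF l] unfolding ivl(1,2) by (auto simp: T_late)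
    show "(\<Sum>j\<in>{1..r + Suc w}. of_bool (T i j = l)) \<le> hi l"
      using i row_v[OF l] bounds[OF l] T'(4)[OF l] unfolding ivl(1,2) by (auto simp: T_late)
  next
    fix l assume l: "l \<in> S"
    have "(\<Sum>i\<in>{v+1..v+w}. \<Sum>j\<in>{1..v+w}. of_bool (T i j = l)) = D' l"
      using T'(5)[OF l] by (simp add: T_late)
    then have "(\<Sum>i\<in>{r+1..r + Suc w}. \<Sum>j\<in>{1..r + Suc w}. of_bool (T i j = l)) = tot y l + D' l"
      unfolding ivl(1,2) using row_v[OF l] by (subst sum.insert) auto
    then show "(\<Sum>i\<in>{r+1..r + Suc w}. \<Sum>j\<in>{1..r + Suc w}. of_bool (T i j = l)) =
        (\<Sum>i\<in>{1..r}. b i l) + e l + 2 * g l"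
      using D'[OF l] by (simp add: D_def)
    have "(\<Sum>i\<in>{v+1..v+w}. of_bool (T i i = l)) = e' l"
      using T'(6)[OF l] by (simp add: T_late)
    then have "(\<Sum>i\<in>{r+1..r + Suc w}. of_bool (T i i = l)) = of_bool (T v v = l) + e' l"
      unfolding ivl(1) by (subst sum.insert) auto
    moreover have "of_bool (T v v = l) = y 0 l" using y_t[of 0] l by (simp add: T_def)
    ultimately show "(\<Sum>i\<in>{r+1..r + Suc w}. of_bool (T i i = l)) = e l"
      using y_e[OF l] by (simp add: e'_def)
  qed
qed

section \<open>Counting occurrences as sums of indicators\<close>

lemma floor_nat_divide: "\<lfloor>real a / real n\<rfloor> = int (a div n)"
  by (simp add: floor_divide_of_nat_eq)

lemma ceiling_nat_divide:
  assumes "0 < n"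
  shows "\<lceil>real a / real n\<rceil> = int (a div n + of_bool (\<not> n dvd a))"
proof (cases "n dvd a")
  case True
  then show ?thesis using assms by (auto simp: dvd_def)
next
  case False
  have "real a / real n \<noteq> of_int (int (a div n))"
    using False assms real_of_nat_div[of n a]
    by (metis dvd_triv_left nonzero_eq_divide_eq of_int_of_nat_eq of_nat_0_eq_iff of_nat_eq_iff
        of_nat_mult dvd_triv_right less_irrefl)
  then show ?thesis
    using False ceiling_altdef[of "real a / real n"] by (simp add: floor_nat_divide)
qed

lemma row_occ_eq_sum: "row_occ s A l i = (\<Sum>j\<in>{1..s}. of_bool (A i j = l))"
  by (simp add: row_occ_def Int_def)

lemma col_occ_eq_sum: "col_occ s A l j = (\<Sum>i\<in>{1..s}. of_bool (A i j = l))"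
  by (simp add: col_occ_def Int_def)

lemma occ_eq_sum: "occ s A l = (\<Sum>i\<in>{1..s}. row_occ s A l i)"
proof -
  have "{(i, j). i \<in> {1..s} \<and> j \<in> {1..s} \<and> A i j = l} = (SIGMA i:{1..s}. {j \<in> {1..s}. A i j = l})"
    by auto
  then show ?thesis by (simp add: occ_def row_occ_def)
qed

lemma sum_indicator_eq_card:
  assumes "finite S" "\<And>i. i \<in> I \<Longrightarrow> f i \<in> S"
  shows "(\<Sum>l\<in>S. \<Sum>i\<in>I. of_bool (f i = l)) = card I"
proof -
  have "(\<Sum>l\<in>S. of_bool (f i = l)) = (1 :: nat)" if "i \<in> I" for i
  proof -
    have "S \<inter> {l. f i = l} = {f i}" using assms(2)[OF that] by auto
    then show ?thesis using assms(1) by simp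
  qed
  then show ?thesis by (subst sum.swap) simp
qed

lemma symmetric_double_sum:
  fixes f :: "'a \<Rightarrow> 'a \<Rightarrow> nat"
  assumes "finite I" "\<And>i j. i \<in> I \<Longrightarrow> j \<in> I \<Longrightarrow> f i j = f j i"
  shows "\<exists>g. (\<Sum>i\<in>I. \<Sum>j\<in>I. f i j) = (\<Sum>i\<in>I. f i i) + 2 * g"
  using assms
proof (induction rule: finite_induct)
  case empty
  then show ?case by simp
next
  case (insert a I)
  then obtain g where g: "(\<Sum>i\<in>I. \<Sum>j\<in>I. f i j) = (\<Sum>i\<in>I. f i i) + 2 * g" by auto
  have "(\<Sum>i\<in>I. f i a) = (\<Sum>j\<in>I. f a j)" using insert.prems by (intro sum.cong) auto
  then show ?case using insert.hyps g
    by (intro exI[of _ "g + (\<Sum>j\<in>I. f a j)"]) (simp add: sum.distrib)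
qed

lemma exists_bounded_sum:
  fixes h :: "'a \<Rightarrow> nat"
  assumes "finite S" "t \<le> (\<Sum>l\<in>S. h l)"
  shows "\<exists>f. (\<forall>l\<in>S. f l \<le> h l) \<and> (\<Sum>l\<in>S. f l) = t"
  using assms
proof (induction arbitrary: t rule: finite_induct)
  case empty
  then show ?case by simp
next
  case (insert a S)
  have "t - min t (h a) \<le> (\<Sum>l\<in>S. h l)" using insert by (auto simp: min_def)
  then obtain f where f: "\<forall>l\<in>S. f l \<le> h l" "(\<Sum>l\<in>S. f l) = t - min t (h a)"
    using insert.IH by blast
  have "(\<Sum>l\<in>S. (f(a := min t (h a))) l) = (\<Sum>l\<in>S. f l)"
    using insert.hyps by (intro sum.cong) auto
  then show ?case using f insert.hyps
    by (intro exI[of _ "f(a := min t (h a))"]) auto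
qed

lemma row_occ_extends:
  assumes "array_extends r M N" "i \<in> {1..r}" "r \<le> n"
  shows "row_occ n N l i = row_occ r M l i + (\<Sum>j\<in>{r+1..n}. of_bool (N i j = l))"
proof -
  have ivl: "{1..n} = {1..r} \<union> {r+1..n}" using assms(3) by auto
  have "(\<Sum>j\<in>{1..r}. of_bool (N i j = l)) = row_occ r M l i"
    unfolding row_occ_eq_sum using assms by (intro sum.cong) (auto simp: array_extends_def)
  then show ?thesis
    unfolding row_occ_eq_sum[of n] ivl by (subst sum.union_disjoint) auto
qed

text \<open>The first \<open>r\<close> columns of the tail rows mirror the top right block, and the
  off-diagonal cells of the symmetric block come in equal pairs, whence the even term.\<close>

lemma tail_row_occ:
  assumes "symmetric_off n r N" "r \<le> n"
  shows "\<exists>g. (\<Sum>i\<in>{r+1..n}. row_occ n N l i) =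
    (\<Sum>i\<in>{1..r}. \<Sum>j\<in>{r+1..n}. of_bool (N i j = l)) + (\<Sum>i\<in>{r+1..n}. of_bool (N i i = l)) + 2 * g"
proof -
  have ivl: "{1..n} = {1..r} \<union> {r+1..n}" using assms(2) by auto
  have swap: "N i j = N j i" if "i \<in> {r+1..n}" "j \<in> {1..r}" for i j
    using assms(1) that unfolding symmetric_off_def by blast
  have "(\<Sum>i\<in>{r+1..n}. row_occ n N l i) =
      (\<Sum>i\<in>{r+1..n}. (\<Sum>j\<in>{1..r}. of_bool (N i j = l)) + (\<Sum>j\<in>{r+1..n}. of_bool (N i j = l)))"
    unfolding row_occ_eq_sum ivl by (subst sum.union_disjoint) auto
  also have "\<dots> = (\<Sum>i\<in>{r+1..n}. \<Sum>j\<in>{1..r}. of_bool (N i j = l)) +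
      (\<Sum>i\<in>{r+1..n}. \<Sum>j\<in>{r+1..n}. of_bool (N i j = l))"
    by (rule sum.distrib)
  also have "(\<Sum>i\<in>{r+1..n}. \<Sum>j\<in>{1..r}. of_bool (N i j = l) :: nat) =
      (\<Sum>i\<in>{r+1..n}. \<Sum>j\<in>{1..r}. of_bool (N j i = l))"
    by (intro sum.cong refl) (metis swap)
  also have "\<dots> = (\<Sum>i\<in>{1..r}. \<Sum>j\<in>{r+1..n}. of_bool (N i j = l))" by (rule sum.swap)
  finally show ?thesis
    using symmetric_double_sum[of "{r+1..n}" "\<lambda>i j. of_bool (N i j = l)"] assms(1)
    by (auto simp: symmetric_off_def)
qed

section \<open>The hypotheses in integer arithmetic\<close>

locale extension_problem =
  fixes r k n :: nat and \<rho> d :: "nat \<Rightarrow> nat" and M :: array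
  assumes n_pos: "0 < n" and r_le: "r \<le> n"
    and sum_\<rho>: "(\<Sum>l\<in>{1..k}. \<rho> l) = n ^ 2"
    and rect: "equitable_latin_rectangle n k \<rho> r M"
    and ext_sym: "externally_symmetric k r M"
begin

definition c :: "nat \<Rightarrow> nat" where "c l = \<rho> l div n + of_bool (\<not> n dvd \<rho> l)"

definition Y :: "nat set" where "Y = {l \<in> {1..k}. \<not> n dvd \<rho> l}"

text \<open>The first entry reserves \<open>d l\<close> cells of the symmetric block, the second
  keeps the last \<open>n - r\<close> rows at the floor on average; both are solved for the total
  deficiency of \<open>l\<close> over rows \<open>1..r\<close>.\<close>

definition lower :: "nat \<Rightarrow> int" where
  "lower l = Max {int r * int (c l) - \<lfloor>(real (\<rho> l) + real (occ r M l) - real (d l)) / 2\<rfloor>,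
     int r * (int (c l) - int (\<rho> l div n)) + int n * int (\<rho> l div n) - int (\<rho> l), 0}"

text \<open>The deficiency that every row must have: the ceilings add up to this much more than the
  \<open>n\<close> cells of a row.\<close>

definition excess :: int where "excess = (\<Sum>l\<in>{1..k}. int (c l)) - int n"

text \<open>Here \<open>l\<close> ranges over \<open>Y\<close>, whose members are free, so
  \<open>eta_rows\<close> is written as the bare cardinality; \<open>symbol_condition\<close> treats
  \<open>eta_symbols\<close> alike.\<close>

definition row_condition :: bool where
  "row_condition \<longleftrightarrow> (\<forall>I\<subseteq>{1..r}. int (card I) * excess \<le>
     (\<Sum>l\<in>Y. min (int n * int (c l) - int (\<rho> l)) (int (card {i \<in> I. row_occ r M l i < c l}))))"

definition symbol_condition :: bool where
  "symbol_condition \<longleftrightarrow> (\<forall>K\<subseteq>Y. (\<Sum>l\<in>K. lower l) \<le>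
     (\<Sum>i\<in>{1..r}. min excess (int (card {l \<in> K. row_occ r M l i < c l}))))"

lemma floor_\<rho>: "\<lfloor>real (\<rho> l) / real n\<rfloor> = int (\<rho> l div n)"
  by (rule floor_nat_divide)

lemma ceiling_\<rho>: "\<lceil>real (\<rho> l) / real n\<rceil> = int (c l)"
  unfolding c_def using n_pos by (rule ceiling_nat_divide)

lemma finite_Y: "finite Y" by (simp add: Y_def)

lemma Y_subset: "Y \<subseteq> {1..k}" by (auto simp: Y_def)

lemma c_free: "l \<in> Y \<Longrightarrow> c l = Suc (\<rho> l div n)" by (simp add: c_def Y_def)

lemma c_forced: "l \<in> {1..k} - Y \<Longrightarrow> c l = \<rho> l div n" by (simp add: c_def Y_def)

lemma \<rho>_forced: "l \<in> {1..k} - Y \<Longrightarrow> \<rho> l = n * c l" by (simp add: c_forced) (simp add: Y_def)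

lemma \<rho>_le: "\<rho> l \<le> n * c l"
  using dividend_less_times_div[OF n_pos, of "\<rho> l"] by (auto simp: c_def)

text \<open>An integer is at most a floor iff it is at most the number itself. Against an integer
  \<open>x\<close> the maximum, the floor and the halving thus become linear inequalities.\<close>

lemma lower_le_iff:
  "lower l \<le> x \<longleftrightarrow>
     2 * int r * int (c l) + int (d l) \<le> int (\<rho> l) + int (occ r M l) + 2 * x \<and>
     int r * (int (c l) - int (\<rho> l div n)) + int n * int (\<rho> l div n) \<le> int (\<rho> l) + x \<and> 0 \<le> x"
proof -
  have "int r * int (c l) - \<lfloor>(real (\<rho> l) + real (occ r M l) - real (d l)) / 2\<rfloor> \<le> x \<longleftrightarrow>
      int r * int (c l) - x \<le> \<lfloor>(real (\<rho> l) + real (occ r M l) - real (d l)) / 2\<rfloor>" by linarith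
  also have "\<dots> \<longleftrightarrow> real_of_int (2 * (int r * int (c l) - x)) \<le>
      real_of_int (int (\<rho> l) + int (occ r M l) - int (d l))"
    by (subst le_floor_iff) (simp add: field_simps)
  also have "\<dots> \<longleftrightarrow> 2 * int r * int (c l) + int (d l) \<le> int (\<rho> l) + int (occ r M l) + 2 * x"
    unfolding of_int_le_iff by (auto simp: algebra_simps)
  finally show ?thesis by (auto simp: lower_def)
qed

lemma excess_nonneg: "0 \<le> excess"
proof -
  have "n * n \<le> n * (\<Sum>l\<in>{1..k}. c l)"
    using sum_\<rho> sum_mono[of "{1..k}" \<rho> "\<lambda>l. n * c l"] \<rho>_le
    by (simp add: sum_distrib_left power2_eq_square)
  then have "n \<le> (\<Sum>l\<in>{1..k}. c l)" using n_pos by simp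
  then show ?thesis unfolding excess_def by (simp flip: of_nat_sum)
qed

lemma row_sum_M: "i \<in> {1..r} \<Longrightarrow> (\<Sum>l\<in>{1..k}. row_occ r M l i) = r"
  unfolding row_occ_eq_sum using rect
  by (subst sum_indicator_eq_card) (auto simp: equitable_latin_rectangle_def symbols_from_def)

lemma row_le_M: "i \<in> {1..r} \<Longrightarrow> l \<in> {1..k} \<Longrightarrow> row_occ r M l i \<le> c l"
  using rect by (simp add: equitable_latin_rectangle_def ceiling_\<rho>)

lemma sum_occ_M: "(\<Sum>l\<in>{1..k}. occ r M l) = r * r"
proof -
  have "(\<Sum>l\<in>{1..k}. occ r M l) = (\<Sum>i\<in>{1..r}. \<Sum>l\<in>{1..k}. row_occ r M l i)"
    unfolding occ_eq_sum by (rule sum.swap)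
  also have "\<dots> = (\<Sum>i\<in>{1..r}. r)" using row_sum_M by (intro sum.cong) auto
  finally show ?thesis by simp
qed

text \<open>Differences are moved across the inequalities, and modulo 2 signs do not matter, so
  everything can be read over natural numbers; \<open>n - r\<close> is exact by
  \<open>r_le\<close>.\<close>

lemma admissible_iff:
  "equitably_admissible n k \<rho> d r M \<longleftrightarrow>
     (\<forall>l\<in>{1..k}. occ r M l + d l \<le> \<rho> l) \<and>
     (\<forall>l\<in>{1..k}. (n - r) * (\<rho> l div n) + occ r M l \<le> \<rho> l \<and>
        \<rho> l + d l \<le> 2 * (n - r) * c l + occ r M l) \<and>
     card {l \<in> {1..k}. odd (\<rho> l + occ r M l + d l)} + (\<Sum>l\<in>{1..k}. d l) \<le> n - r \<and>
     even (n - r + (\<Sum>l\<in>{1..k}. d l) + card {l \<in> {1..k}. odd (\<rho> l + occ r M l + d l)})"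
proof -
  have nr: "int n - int r = int (n - r)" using r_le by simp
  have bounds: "int (n - r) * int (\<rho> l div n) \<le> int (\<rho> l) - int (occ r M l) \<longleftrightarrow>
      (n - r) * (\<rho> l div n) + occ r M l \<le> \<rho> l"
    "int (\<rho> l) - int (occ r M l) \<le> 2 * int (n - r) * int (c l) - int (d l) \<longleftrightarrow>
      \<rho> l + d l \<le> 2 * (n - r) * c l + occ r M l" for l
    by (simp_all only: flip: of_nat_mult of_nat_le_iff[where 'a = int])
       (simp_all only: of_nat_add of_nat_mult of_nat_numeral, linarith+)
  have par: "\<not> [int (\<rho> l) - int (occ r M l) - int (d l) = 0] (mod 2) \<longleftrightarrow>
      odd (\<rho> l + occ r M l + d l)"
    "odd (int (\<rho> l) - int (occ r M l) - int (d l)) \<longleftrightarrow> odd (\<rho> l + occ r M l + d l)" for l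
    by (simp_all add: cong_0_iff)
  define P where "P = card {l \<in> {1..k}. odd (\<rho> l + occ r M l + d l)}"
  have last: "[int (n - r) - int D = int P] (mod 2) \<longleftrightarrow> even (n - r + D + P)" for D
    by (simp add: cong_iff_dvd_diff)
  have c: "int P \<le> int (n - r) - int D \<longleftrightarrow> P + D \<le> n - r" for D by linarith
  show ?thesis
    unfolding equitably_admissible_def floor_\<rho> ceiling_\<rho> nr bounds par
      of_nat_sum[symmetric] P_def[symmetric] last c by simp
qed

section \<open>Necessity of the conditions\<close>

text \<open>Each of the two Hall-type inequalities is one double sum of the deficiencies of
  \<open>N\<close>, bounded line by line before and after exchanging the order of summation.\<close>

lemma conditions_of_extension:
  assumes sq: "equitable_latin_square n k \<rho> N" and ext: "array_extends r M N"
    and sym: "symmetric_off n r N" and tail: "has_diagonal_tail n k r d N"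
  shows "equitably_admissible n k \<rho> d r M" "row_condition" "symbol_condition"
proof -
  define A where "A i l = (\<Sum>j\<in>{r+1..n}. of_bool (N i j = l) :: nat)" for i l
  define E where "E l = (\<Sum>i\<in>{1..r}. A i l)" for l
  define e where "e l = (\<Sum>i\<in>{r+1..n}. of_bool (N i i = l) :: nat)" for l
  define x where "x i l = c l - row_occ n N l i" for i l
  define X where "X l = (\<Sum>i\<in>{1..r}. x i l)" for l
  have "\<exists>g. \<forall>l. (\<Sum>i\<in>{r+1..n}. row_occ n N l i) = E l + e l + 2 * g l"
    using tail_row_occ[OF sym r_le] unfolding E_def A_def e_def by (intro choice) blast
  then obtain g where tail_sum: "(\<Sum>i\<in>{r+1..n}. row_occ n N l i) = E l + e l + 2 * g l" for l
    by blast
  have symb: "N i j \<in> {1..k}" if "i \<in> {1..n}" "j \<in> {1..n}" for i j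
    using sq that by (simp add: equitable_latin_square_def symbols_from_def)
  have row: "row_occ n N l i = row_occ r M l i + A i l" if "i \<in> {1..r}" for i l
    unfolding A_def by (rule row_occ_extends[OF ext that r_le])
  have row_le: "row_occ n N l i \<le> c l" and row_ge: "\<rho> l div n \<le> row_occ n N l i"
    if "i \<in> {1..n}" "l \<in> {1..k}" for i l
    using sq that by (auto simp: equitable_latin_square_def floor_\<rho> ceiling_\<rho>)
  have ivl: "{1..n} = {1..r} \<union> {r+1..n}" using r_le by auto
  \<comment> \<open>By blocks: \<open>M\<close>, the top right block and its mirror image, then the
    diagonal and the paired cells of the symmetric block.\<close>
  have total: "\<rho> l = occ r M l + 2 * E l + e l + 2 * g l" if "l \<in> {1..k}" for l
  proof -
    have "\<rho> l = (\<Sum>i\<in>{1..n}. row_occ n N l i)"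
      unfolding occ_eq_sum[symmetric] using sq that by (simp add: equitable_latin_square_def)
    also have "\<dots> = (\<Sum>i\<in>{1..r}. row_occ n N l i) + (\<Sum>i\<in>{r+1..n}. row_occ n N l i)"
      unfolding ivl by (rule sum.union_disjoint) auto
    also have "(\<Sum>i\<in>{1..r}. row_occ n N l i) = occ r M l + E l"
      unfolding occ_eq_sum E_def sum.distrib[symmetric] using row by (intro sum.cong) auto
    finally show ?thesis using tail_sum by simp
  qed
  have tail_ge: "(n - r) * (\<rho> l div n) \<le> E l + e l + 2 * g l" if "l \<in> {1..k}" for l
    unfolding tail_sum[symmetric]
    using sum_bounded_below[of "{r+1..n}" "\<rho> l div n" "row_occ n N l"] row_ge[OF _ that] by simp
  have tail_le: "E l + e l + 2 * g l \<le> (n - r) * c l" if "l \<in> {1..k}" for l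
    unfolding tail_sum[symmetric]
    using sum_bounded_above[of "{r+1..n}" "row_occ n N l" "c l"] row_le[OF _ that] by simp
  have d_le: "d l \<le> e l" if "l \<in> {1..k}" for l
    using tail that by (simp add: has_diagonal_tail_def e_def Int_def)
  have sum_e: "(\<Sum>l\<in>{1..k}. e l) = n - r"
    unfolding e_def using symb by (subst sum_indicator_eq_card) auto
  have rc: "r * c l = X l + occ r M l + E l" if "l \<in> {1..k}" for l
  proof -
    have "X l + occ r M l + E l = (\<Sum>i\<in>{1..r}. x i l + row_occ r M l i + A i l)"
      unfolding X_def occ_eq_sum E_def by (simp add: sum.distrib)
    also have "\<dots> = (\<Sum>i\<in>{1..r}. c l)"
    proof (rule sum.cong[OF refl])
      fix i assume i: "i \<in> {1..r}"
      then show "x i l + row_occ r M l i + A i l = c l"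
        using row[OF i, of l] row_le[of i l] that r_le by (simp add: x_def)
    qed
    finally show ?thesis by simp
  qed
  \<comment> \<open>The floor is \<open>c l - 1\<close> for a free symbol and \<open>c l\<close> for
    a forced one, and a row of \<open>M\<close> already at the ceiling has no deficiency.\<close>
  have x_le: "x i l \<le> of_bool (l \<in> Y \<and> row_occ r M l i < c l)"
    if "i \<in> {1..r}" "l \<in> {1..k}" for i l
    using row[OF that(1), of l] row_ge[of i l] c_free[of l] c_forced[of l] that r_le
    by (cases "l \<in> Y") (auto simp: x_def)
  have excess_eq: "(\<Sum>l\<in>Y. int (x i l)) = excess" if i: "i \<in> {1..r}" for i
  proof -
    have "(\<Sum>l\<in>Y. int (x i l)) = (\<Sum>l\<in>{1..k}. int (x i l))"
      using Y_subset x_le[OF i] by (intro sum.mono_neutral_left) force+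
    also have "\<dots> = (\<Sum>l\<in>{1..k}. int (c l) - int (row_occ n N l i))"
      using row_le[of i] i r_le by (intro sum.cong) (auto simp: x_def of_nat_diff)
    also have "\<dots> = (\<Sum>l\<in>{1..k}. int (c l)) - int (\<Sum>l\<in>{1..k}. row_occ n N l i)"
      by (simp add: sum_subtractf)
    also have "(\<Sum>l\<in>{1..k}. row_occ n N l i) = n"
      unfolding row_occ_eq_sum using symb i r_le by (subst sum_indicator_eq_card) auto
    finally show ?thesis by (simp add: excess_def)
  qed
  have nr: "n * a = r * a + (n - r) * a" for a
    using r_le by (simp flip: add_mult_distrib)
  show "equitably_admissible n k \<rho> d r M"
    unfolding admissible_iff
  proof (intro conjI ballI)
    fix l assume l: "l \<in> {1..k}"
    show "occ r M l + d l \<le> \<rho> l" using total[OF l] d_le[OF l] by simp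
    show "(n - r) * (\<rho> l div n) + occ r M l \<le> \<rho> l" using total[OF l] tail_ge[OF l] by linarith
    show "\<rho> l + d l \<le> 2 * (n - r) * c l + occ r M l"
      using total[OF l] tail_le[OF l] d_le[OF l] by (simp add: mult.assoc)
  next
    define odds where "odds = {l \<in> {1..k}. odd (\<rho> l + occ r M l + d l)}"
    \<comment> \<open>The diagonal cells beyond the prescribed ones. By \<open>total\<close> each
      has the parity tested in (c) and (d), so every odd symbol takes at least one of them and the
      others come in twos.\<close>
    define z where "z l = e l - d l" for l
    have odd_z: "odd (\<rho> l + occ r M l + d l) \<longleftrightarrow> odd (z l)" if "l \<in> {1..k}" for l
      using d_le[OF that] by (subst total[OF that]) (auto simp: z_def)
    then have odds: "card odds = (\<Sum>l\<in>{1..k}. of_bool (odd (z l)))"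
      unfolding odds_def by (simp add: Int_def cong: conj_cong)
    have sum_z: "(\<Sum>l\<in>{1..k}. z l) + (\<Sum>l\<in>{1..k}. d l) = n - r"
      unfolding sum_e[symmetric] sum.distrib[symmetric] using d_le by (intro sum.cong) (auto simp: z_def)
    have z: "z l = of_bool (odd (z l)) + 2 * (z l div 2)" for l by (cases "even (z l)") auto
    have "(\<Sum>l\<in>{1..k}. z l) = card odds + 2 * (\<Sum>l\<in>{1..k}. z l div 2)"
      unfolding odds sum_distrib_left sum.distrib[symmetric] using z by (intro sum.cong) auto
    then show "card odds + (\<Sum>l\<in>{1..k}. d l) \<le> n - r"
      "even (n - r + (\<Sum>l\<in>{1..k}. d l) + card odds)"
      using sum_z by (simp_all flip: sum_z)
  qed
  show row_condition
    unfolding row_condition_def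
  proof (intro allI impI)
    fix I assume I: "I \<subseteq> {1..r}"
    then have finI: "finite I" using finite_subset by blast
    have "int (card I) * excess = (\<Sum>i\<in>I. \<Sum>l\<in>Y. int (x i l))"
      using excess_eq I by (simp add: subset_iff)
    also have "\<dots> = (\<Sum>l\<in>Y. \<Sum>i\<in>I. int (x i l))" by (rule sum.swap)
    also have "\<dots> \<le> (\<Sum>l\<in>Y. min (int n * int (c l) - int (\<rho> l))
        (int (card {i \<in> I. row_occ r M l i < c l})))"
    proof (intro sum_mono min.boundedI)
      fix l assume "l \<in> Y"
      then have l: "l \<in> {1..k}" using Y_subset by auto
      have "(\<Sum>i\<in>I. x i l) \<le> X l" unfolding X_def using I by (intro sum_mono2) auto
      \<comment> \<open>This is \<open>tail_le\<close> solved for the total deficiency.\<close>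
      moreover have "X l + \<rho> l \<le> n * c l"
        using total[OF l] rc[OF l] tail_le[OF l] by (simp add: nr)
      ultimately have "(\<Sum>i\<in>I. x i l) + \<rho> l \<le> n * c l" by linarith
      then have "int ((\<Sum>i\<in>I. x i l) + \<rho> l) \<le> int (n * c l)" by (rule of_nat_mono)
      then show "(\<Sum>i\<in>I. int (x i l)) \<le> int n * int (c l) - int (\<rho> l)" by simp
      have "(\<Sum>i\<in>I. x i l) \<le> (\<Sum>i\<in>I. of_bool (row_occ r M l i < c l))"
      proof (rule sum_mono)
        fix i assume "i \<in> I"
        then show "x i l \<le> of_bool (row_occ r M l i < c l)"
          using x_le[of i l] l I \<open>l \<in> Y\<close> by auto
      qed
      also have "\<dots> = card {i \<in> I. row_occ r M l i < c l}" using finI by (simp add: Int_def)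
      finally show "(\<Sum>i\<in>I. int (x i l)) \<le> int (card {i \<in> I. row_occ r M l i < c l})"
        by (simp flip: of_nat_sum)
    qed
    finally show "int (card I) * excess \<le> (\<Sum>l\<in>Y. min (int n * int (c l) - int (\<rho> l))
        (int (card {i \<in> I. row_occ r M l i < c l})))" .
  qed
  show symbol_condition
    unfolding symbol_condition_def
  proof (intro allI impI)
    fix K assume K: "K \<subseteq> Y"
    then have finK: "finite K" using finite_Y finite_subset by blast
    have "(\<Sum>l\<in>K. lower l) \<le> (\<Sum>l\<in>K. \<Sum>i\<in>{1..r}. int (x i l))"
    proof (rule sum_mono)
      fix l assume "l \<in> K"
      then have l: "l \<in> {1..k}" using K Y_subset by auto
      \<comment> \<open>This bound and the next are \<open>d_le\<close> and \<open>tail_ge\<close>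
        solved for \<open>X l\<close>.\<close>
      have "2 * (r * c l) + d l \<le> \<rho> l + occ r M l + 2 * X l"
        using total[OF l] rc[OF l] d_le[OF l] by linarith
      then have "int (2 * (r * c l) + d l) \<le> int (\<rho> l + occ r M l + 2 * X l)" by (rule of_nat_mono)
      moreover have "r * c l + n * (\<rho> l div n) \<le> \<rho> l + X l + r * (\<rho> l div n)"
        using total[OF l] rc[OF l] tail_ge[OF l] nr[of "\<rho> l div n"] by linarith
      then have "int (r * c l + n * (\<rho> l div n)) \<le> int (\<rho> l + X l + r * (\<rho> l div n))"
        by (rule of_nat_mono)
      ultimately have "lower l \<le> int (X l)"
        unfolding lower_le_iff by (simp add: algebra_simps)
      then show "lower l \<le> (\<Sum>i\<in>{1..r}. int (x i l))" by (simp add: X_def)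
    qed
    also have "\<dots> = (\<Sum>i\<in>{1..r}. \<Sum>l\<in>K. int (x i l))" by (rule sum.swap)
    also have "\<dots> \<le> (\<Sum>i\<in>{1..r}. min excess (int (card {l \<in> K. row_occ r M l i < c l})))"
    proof (intro sum_mono min.boundedI)
      fix i assume i: "i \<in> {1..r}"
      show "(\<Sum>l\<in>K. int (x i l)) \<le> excess"
        unfolding excess_eq[OF i, symmetric] using K finite_Y by (intro sum_mono2) auto
      have "(\<Sum>l\<in>K. x i l) \<le> (\<Sum>l\<in>K. of_bool (row_occ r M l i < c l))"
      proof (rule sum_mono)
        fix l assume "l \<in> K"
        then have "l \<in> Y" "l \<in> {1..k}" using K Y_subset by auto
        then show "x i l \<le> of_bool (row_occ r M l i < c l)"
          using x_le[OF i, of l] by simp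
      qed
      also have "\<dots> = card {l \<in> K. row_occ r M l i < c l}" using finK by (simp add: Int_def)
      finally show "(\<Sum>l\<in>K. int (x i l)) \<le> int (card {l \<in> K. row_occ r M l i < c l})"
        by (simp flip: of_nat_sum)
    qed
    finally show "(\<Sum>l\<in>K. lower l) \<le>
        (\<Sum>i\<in>{1..r}. min excess (int (card {l \<in> K. row_occ r M l i < c l})))" .
  qed
qed

section \<open>Sufficiency of the conditions\<close>

text \<open>An edge joins a row to a free symbol below its ceiling there, so the two conditions are
  the criteria of \<open>degree_interval_subgraph\<close>. What remains is that the degree interval
  of each symbol is nonempty; this is where the upper half of (b) enters.\<close>

lemma deficiency_exists:
  assumes adm: "equitably_admissible n k \<rho> d r M" and row_condition symbol_condition
  shows "\<exists>x :: nat \<Rightarrow> nat \<Rightarrow> nat.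
    (\<forall>i\<in>{1..r}. \<forall>l\<in>{1..k}. x i l \<le> of_bool (l \<in> Y \<and> row_occ r M l i < c l)) \<and>
    (\<forall>i\<in>{1..r}. (\<Sum>l\<in>{1..k}. x i l) + n = (\<Sum>l\<in>{1..k}. c l)) \<and>
    (\<forall>l\<in>Y. lower l \<le> int (\<Sum>i\<in>{1..r}. x i l) \<and> (\<Sum>i\<in>{1..r}. x i l) + \<rho> l \<le> n * c l)"
proof -
  define E where "E = {(i, l). i \<in> {1..r} \<and> l \<in> Y \<and> row_occ r M l i < c l}"
  have lower_nonneg: "0 \<le> lower l" for l using lower_le_iff[of l "lower l"] by simp
  have "\<exists>G\<subseteq>E. (\<forall>i\<in>{1..r}. card (G `` {i}) = nat excess) \<and>
    (\<forall>l\<in>Y. nat (lower l) \<le> card (G\<inverse> `` {l}) \<and> card (G\<inverse> `` {l}) \<le> n * c l - \<rho> l)"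
  proof (rule degree_interval_subgraph[OF _ finite_Y])
    show "E \<subseteq> {1..r} \<times> Y" by (auto simp: E_def)
  next
    fix l assume "l \<in> Y"
    then have l: "l \<in> {1..k}" and c: "c l = Suc (\<rho> l div n)" using Y_subset c_free by auto
    have nc: "n * c l = r * c l + (n - r) * c l" using r_le by (simp flip: add_mult_distrib)
    have "\<rho> l + d l \<le> 2 * ((n - r) * c l) + occ r M l"
      using adm l by (simp add: admissible_iff mult.assoc)
    then have "int (2 * (r * c l) + d l + 2 * \<rho> l) \<le> int (\<rho> l + occ r M l + 2 * (n * c l))"
      unfolding nc of_nat_le_iff by simp
    moreover have "int (r * c l + n * (\<rho> l div n)) \<le> int (n * c l + r * (\<rho> l div n))"
      unfolding c of_nat_le_iff using r_le by simp
    moreover have "int (\<rho> l) \<le> int (n * c l)" using \<rho>_le by (rule of_nat_mono)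
    ultimately have "lower l \<le> int (n * c l) - int (\<rho> l)"
      unfolding lower_le_iff by (simp add: algebra_simps)
    then show "nat (lower l) \<le> n * c l - \<rho> l" by linarith
  next
    fix I assume I: "I \<subseteq> {1..r}"
    have "int (\<Sum>i\<in>I. nat excess) = int (card I) * excess" using excess_nonneg by simp
    also have "\<dots> \<le> (\<Sum>l\<in>Y. min (int n * int (c l) - int (\<rho> l))
        (int (card {i \<in> I. row_occ r M l i < c l})))"
      using \<open>row_condition\<close> I by (simp add: row_condition_def)
    also have "\<dots> = int (\<Sum>l\<in>Y. min (n * c l - \<rho> l) (card (E\<inverse> `` {l} \<inter> I)))"
      unfolding of_nat_sum
    proof (rule sum.cong[OF refl])
      fix l assume "l \<in> Y"
      then have "E\<inverse> `` {l} \<inter> I = {i \<in> I. row_occ r M l i < c l}" using I by (auto simp: E_def)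
      then show "min (int n * int (c l) - int (\<rho> l)) (int (card {i \<in> I. row_occ r M l i < c l})) =
          int (min (n * c l - \<rho> l) (card (E\<inverse> `` {l} \<inter> I)))"
        using \<rho>_le[of l] by (simp add: of_nat_diff of_nat_min)
    qed
    finally show "(\<Sum>i\<in>I. nat excess) \<le> (\<Sum>l\<in>Y. min (n * c l - \<rho> l) (card (E\<inverse> `` {l} \<inter> I)))"
      by (simp only: of_nat_le_iff)
  next
    fix K assume K: "K \<subseteq> Y"
    have "int (\<Sum>l\<in>K. nat (lower l)) = (\<Sum>l\<in>K. lower l)" using lower_nonneg by simp
    also have "\<dots> \<le> (\<Sum>i\<in>{1..r}. min excess (int (card {l \<in> K. row_occ r M l i < c l})))"
      using \<open>symbol_condition\<close> K by (simp add: symbol_condition_def)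
    also have "\<dots> = int (\<Sum>i\<in>{1..r}. min (nat excess) (card (E `` {i} \<inter> K)))"
      unfolding of_nat_sum
    proof (rule sum.cong[OF refl])
      fix i assume "i \<in> {1..r}"
      then have "E `` {i} \<inter> K = {l \<in> K. row_occ r M l i < c l}" using K by (auto simp: E_def)
      then show "min excess (int (card {l \<in> K. row_occ r M l i < c l})) =
          int (min (nat excess) (card (E `` {i} \<inter> K)))"
        using excess_nonneg by (simp add: of_nat_min)
    qed
    finally show "(\<Sum>l\<in>K. nat (lower l)) \<le> (\<Sum>i\<in>{1..r}. min (nat excess) (card (E `` {i} \<inter> K)))"
      by (simp only: of_nat_le_iff)
  qed simp
  then obtain G where G: "G \<subseteq> E" "\<And>i. i \<in> {1..r} \<Longrightarrow> card (G `` {i}) = nat excess"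
    "\<And>l. l \<in> Y \<Longrightarrow> nat (lower l) \<le> card (G\<inverse> `` {l})"
    "\<And>l. l \<in> Y \<Longrightarrow> card (G\<inverse> `` {l}) \<le> n * c l - \<rho> l" by blast
  define x where "x i l = (of_bool ((i, l) \<in> G) :: nat)" for i l
  have row: "(\<Sum>l\<in>{1..k}. x i l) = card (G `` {i})" for i
  proof -
    have "G `` {i} = {1..k} \<inter> {l. (i, l) \<in> G}" using G(1) Y_subset by (auto simp: E_def)
    then show ?thesis by (simp add: x_def)
  qed
  have col: "(\<Sum>i\<in>{1..r}. x i l) = card (G\<inverse> `` {l})" for l
  proof -
    have "G\<inverse> `` {l} = {1..r} \<inter> {i. (i, l) \<in> G}" using G(1) by (auto simp: E_def)
    then show ?thesis by (simp add: x_def)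
  qed
  show ?thesis
  proof (intro exI[of _ x] conjI ballI)
    show "x i l \<le> of_bool (l \<in> Y \<and> row_occ r M l i < c l)" for i l
      using G(1) by (auto simp: x_def E_def)
    show "(\<Sum>l\<in>{1..k}. x i l) + n = (\<Sum>l\<in>{1..k}. c l)" if "i \<in> {1..r}" for i
      unfolding row G(2)[OF that] using excess_nonneg
      unfolding excess_def of_nat_sum[symmetric] by linarith
    show "lower l \<le> int (\<Sum>i\<in>{1..r}. x i l)" if "l \<in> Y" for l
      unfolding col using G(3)[OF that] by linarith
    show "(\<Sum>i\<in>{1..r}. x i l) + \<rho> l \<le> n * c l" if "l \<in> Y" for l
      unfolding col using G(4)[OF that] \<rho>_le[of l] by linarith
  qed
qed

text \<open>\<open>\<tau> l\<close> copies of \<open>l\<close> go to the symmetric block. The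
  diagonal takes \<open>d l\<close> of them, one more if an odd number is left, and then pairs until
  it is full; the remaining pairs go off the diagonal.\<close>

lemma diagonal_exists:
  assumes adm: "equitably_admissible n k \<rho> d r M"
    and occ: "\<And>l. l \<in> {1..k} \<Longrightarrow> \<rho> l = occ r M l + 2 * E l + \<tau> l"
    and d_le: "\<And>l. l \<in> {1..k} \<Longrightarrow> d l \<le> \<tau> l"
    and sum_\<tau>: "(\<Sum>l\<in>{1..k}. \<tau> l) = (n - r) * (n - r)"
  shows "\<exists>e g. (\<forall>l\<in>{1..k}. d l \<le> e l \<and> \<tau> l = e l + 2 * g l) \<and>
    (\<Sum>l\<in>{1..k}. e l) = n - r \<and> 2 * (\<Sum>l\<in>{1..k}. g l) = (n - r) * (n - r - 1)"
proof -
  define w where "w = n - r"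
  define p where "p l = (of_bool (odd (\<tau> l - d l)) :: nat)" for l
  define h where "h l = (\<tau> l - d l) div 2" for l
  have \<tau>: "\<tau> l = d l + p l + 2 * h l" if "l \<in> {1..k}" for l
  proof -
    have "m = of_bool (odd m) + 2 * (m div 2)" for m :: nat by (cases "even m") auto
    then have "\<tau> l - d l = p l + 2 * h l" unfolding p_def h_def .
    then show ?thesis using d_le[OF that] by simp
  qed
  define odds where "odds = {l \<in> {1..k}. odd (\<rho> l + occ r M l + d l)}"
  have odd_\<tau>: "odd (\<rho> l + occ r M l + d l) \<longleftrightarrow> odd (\<tau> l - d l)" if "l \<in> {1..k}" for l
    using d_le[OF that] by (subst occ[OF that]) auto
  have "odds = {l \<in> {1..k}. odd (\<tau> l - d l)}"
    unfolding odds_def using odd_\<tau> by (intro Collect_cong conj_cong refl)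
  then have sum_p: "(\<Sum>l\<in>{1..k}. p l) = card odds" by (simp add: p_def Int_def)
  have c: "(\<Sum>l\<in>{1..k}. p l) + (\<Sum>l\<in>{1..k}. d l) \<le> w"
    "even (w + (\<Sum>l\<in>{1..k}. d l) + (\<Sum>l\<in>{1..k}. p l))"
    using adm unfolding admissible_iff sum_p odds_def w_def by blast+
  \<comment> \<open>By (c) and (d) the diagonal cells left after the compulsory ones are even in
    number; \<open>t\<close> counts them in pairs.\<close>
  define t where "t = (w - (\<Sum>l\<in>{1..k}. d l) - (\<Sum>l\<in>{1..k}. p l)) div 2"
  have "even (w - (\<Sum>l\<in>{1..k}. d l) - (\<Sum>l\<in>{1..k}. p l))"
    using c by (simp add: diff_diff_left) (metis add.commute add.left_commute even_add)
  then have w: "w = (\<Sum>l\<in>{1..k}. d l) + (\<Sum>l\<in>{1..k}. p l) + 2 * t"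
    unfolding t_def using c(1) by simp
  have ww: "w * w = (\<Sum>l\<in>{1..k}. d l) + (\<Sum>l\<in>{1..k}. p l) + 2 * (\<Sum>l\<in>{1..k}. h l)"
    unfolding w_def sum_\<tau>[symmetric] sum_distrib_left sum.distrib[symmetric]
    using \<tau> by (intro sum.cong) auto
  \<comment> \<open>The same compulsory cells are subtracted from \<open>w\<close> and from
    \<open>w * w\<close>, so there are at least as many pairs as the diagonal needs.\<close>
  have "w \<le> w * w" by (cases w) auto
  then have "t \<le> (\<Sum>l\<in>{1..k}. h l)" using w ww by linarith
  then obtain f where f: "\<forall>l\<in>{1..k}. f l \<le> h l" "(\<Sum>l\<in>{1..k}. f l) = t"
    using exists_bounded_sum[of "{1..k}" t h] by auto
  define e where "e l = d l + p l + 2 * f l" for l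
  define g where "g l = h l - f l" for l
  have eg: "\<tau> l = e l + 2 * g l" if "l \<in> {1..k}" for l
  proof -
    have "f l \<le> h l" using f(1) that by blast
    then show ?thesis using \<tau>[OF that] unfolding e_def g_def by linarith
  qed
  have sum_e: "(\<Sum>l\<in>{1..k}. e l) = w"
    unfolding e_def sum.distrib sum_distrib_left[symmetric] f(2) using w by simp
  have "w * w = w + 2 * (\<Sum>l\<in>{1..k}. g l)"
  proof -
    have "w * w = (\<Sum>l\<in>{1..k}. e l) + 2 * (\<Sum>l\<in>{1..k}. g l)"
      unfolding w_def sum_\<tau>[symmetric] sum_distrib_left sum.distrib[symmetric]
      using eg by (intro sum.cong) auto
    then show ?thesis unfolding sum_e .
  qed
  then have "2 * (\<Sum>l\<in>{1..k}. g l) = w * (w - 1)"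
    by (simp add: diff_mult_distrib2)
  then show ?thesis using eg sum_e unfolding w_def
    by (intro exI[of _ e] exI[of _ g]) (simp add: e_def)
qed

lemma extension_of_conditions:
  assumes adm: "equitably_admissible n k \<rho> d r M" and row_condition symbol_condition
  shows "\<exists>N. equitable_latin_square n k \<rho> N \<and> array_extends r M N \<and>
    symmetric_off n r N \<and> has_diagonal_tail n k r d N"
proof -
  obtain x :: "nat \<Rightarrow> nat \<Rightarrow> nat" where
    x: "\<And>i l. i \<in> {1..r} \<Longrightarrow> l \<in> {1..k} \<Longrightarrow> x i l \<le> of_bool (l \<in> Y \<and> row_occ r M l i < c l)"
    and x_row: "\<And>i. i \<in> {1..r} \<Longrightarrow> (\<Sum>l\<in>{1..k}. x i l) + n = (\<Sum>l\<in>{1..k}. c l)"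
    and x_lower: "\<And>l. l \<in> Y \<Longrightarrow> lower l \<le> int (\<Sum>i\<in>{1..r}. x i l)"
    and x_upper: "\<And>l. l \<in> Y \<Longrightarrow> (\<Sum>i\<in>{1..r}. x i l) + \<rho> l \<le> n * c l"
    using deficiency_exists[OF assms] by blast
  define w where "w = n - r"
  define b where "b i l = c l - row_occ r M l i - x i l" for i l
  define X where "X l = (\<Sum>i\<in>{1..r}. x i l)" for l
  define E where "E l = (\<Sum>i\<in>{1..r}. b i l)" for l
  have n: "n = r + w" using r_le by (simp add: w_def)
  have b: "b i l + row_occ r M l i + x i l = c l" if "i \<in> {1..r}" "l \<in> {1..k}" for i l
    using x[OF that] row_le_M[OF that]
    by (cases "l \<in> Y \<and> row_occ r M l i < c l") (simp_all add: b_def)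
  have b_row: "(\<Sum>l\<in>{1..k}. b i l) = w" if i: "i \<in> {1..r}" for i
  proof -
    have "(\<Sum>l\<in>{1..k}. b i l) + (\<Sum>l\<in>{1..k}. row_occ r M l i) + (\<Sum>l\<in>{1..k}. x i l) =
        (\<Sum>l\<in>{1..k}. c l)"
      unfolding sum.distrib[symmetric] using b[OF i] by (intro sum.cong) auto
    then show ?thesis using x_row[OF i] row_sum_M[OF i] r_le by (simp add: w_def)
  qed
  have rc: "r * c l = E l + occ r M l + X l" if l: "l \<in> {1..k}" for l
  proof -
    have "E l + occ r M l + X l = (\<Sum>i\<in>{1..r}. b i l + row_occ r M l i + x i l)"
      unfolding X_def occ_eq_sum E_def by (simp add: sum.distrib)
    also have "\<dots> = (\<Sum>i\<in>{1..r}. c l)" using b[OF _ l] by (intro sum.cong) auto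
    finally show ?thesis by simp
  qed
  have nc: "n * a = r * a + w * a" for a unfolding n by (rule add_mult_distrib)
  \<comment> \<open>Room for \<open>d l\<close> copies in the symmetric block, and an average
    between floor and ceiling in the last rows. For free symbols these are the degree bounds on
    \<open>x\<close>; for forced ones the deficiency vanishes, and the first bound comes from
    (b).\<close>
  have key: "occ r M l + 2 * E l + d l \<le> \<rho> l \<and> w * (\<rho> l div n) + occ r M l + E l \<le> \<rho> l \<and>
      \<rho> l \<le> w * c l + occ r M l + E l" if l: "l \<in> {1..k}" for l
  proof (cases "l \<in> Y")
    case True
    have low: "2 * int r * int (c l) + int (d l) \<le> int (\<rho> l) + int (occ r M l) + 2 * int (X l)"
      "int r * (int (c l) - int (\<rho> l div n)) + int n * int (\<rho> l div n) \<le> int (\<rho> l) + int (X l)"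
      using x_lower[OF True] unfolding lower_le_iff X_def by auto
    have "int (2 * (r * c l) + d l) \<le> int (\<rho> l + occ r M l + 2 * X l)"
      using low(1) by simp
    then have 1: "2 * (r * c l) + d l \<le> \<rho> l + occ r M l + 2 * X l" by (simp only: of_nat_le_iff)
    have "int (r * c l + n * (\<rho> l div n)) \<le> int (\<rho> l + X l + r * (\<rho> l div n))"
      using low(2) by (simp add: algebra_simps)
    then have 2: "r * c l + n * (\<rho> l div n) \<le> \<rho> l + X l + r * (\<rho> l div n)"
      by (simp only: of_nat_le_iff)
    show ?thesis
      using 1 2 x_upper[OF True] rc[OF l] nc[of "\<rho> l div n"] nc[of "c l"]
      unfolding X_def[symmetric] by linarith
  next
    case False
    have "x i l = 0" if "i \<in> {1..r}" for i using x[OF that l] False by simp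
    then have X: "X l = 0" by (simp add: X_def)
    have "\<rho> l = n * c l" "\<rho> l div n = c l" using c_forced \<rho>_forced False l by simp_all
    moreover have "\<rho> l + d l \<le> 2 * (w * c l) + occ r M l"
      using adm l by (simp add: admissible_iff w_def mult.assoc)
    ultimately show ?thesis using rc[OF l] X nc[of "c l"] by simp
  qed
  define \<tau> where "\<tau> l = \<rho> l - occ r M l - 2 * E l" for l
  have \<tau>: "\<rho> l = occ r M l + 2 * E l + \<tau> l" "d l \<le> \<tau> l" if "l \<in> {1..k}" for l
    using key[OF that] unfolding \<tau>_def by linarith+
  have "(\<Sum>l\<in>{1..k}. E l) = r * w"
  proof -
    have "(\<Sum>l\<in>{1..k}. E l) = (\<Sum>i\<in>{1..r}. \<Sum>l\<in>{1..k}. b i l)"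
      unfolding E_def by (rule sum.swap)
    also have "\<dots> = (\<Sum>i\<in>{1..r}. w)" using b_row by (intro sum.cong) auto
    finally show ?thesis by simp
  qed
  moreover have "(\<Sum>l\<in>{1..k}. occ r M l) + 2 * (\<Sum>l\<in>{1..k}. E l) + (\<Sum>l\<in>{1..k}. \<tau> l) =
      (\<Sum>l\<in>{1..k}. \<rho> l)"
    unfolding sum_distrib_left sum.distrib[symmetric] using \<tau>(1) by (intro sum.cong) auto
  ultimately have "(\<Sum>l\<in>{1..k}. \<tau> l) = w * w"
    unfolding sum_\<rho> sum_occ_M by (simp add: n power2_eq_square algebra_simps)
  then obtain e g where eg: "\<And>l. l \<in> {1..k} \<Longrightarrow> d l \<le> e l"
    "\<And>l. l \<in> {1..k} \<Longrightarrow> \<tau> l = e l + 2 * g l"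
    "(\<Sum>l\<in>{1..k}. e l) = w" "2 * (\<Sum>l\<in>{1..k}. g l) = w * (w - 1)"
    using diagonal_exists[of E \<tau>, OF adm \<tau>] unfolding w_def by blast
  \<comment> \<open>\<open>E l\<close> is subtracted only once, since the mirror image of the top
    right block lies in the last rows.\<close>
  have D: "(\<Sum>i\<in>{1..r}. b i l) + e l + 2 * g l = \<rho> l - occ r M l - E l" if "l \<in> {1..k}" for l
    using eg(2)[OF that] \<tau>(1)[OF that] unfolding E_def[symmetric] by linarith
  have "\<exists>T :: nat \<Rightarrow> nat \<Rightarrow> nat. (\<forall>i j. T i j = T j i) \<and>
    (\<forall>i\<in>{r+1..r+w}. \<forall>j\<in>{1..r+w}. T i j \<in> {1..k}) \<and>
    (\<forall>l\<in>{1..k}. \<forall>i\<in>{1..r}. (\<Sum>j\<in>{r+1..r+w}. of_bool (T i j = l)) = b i l) \<and>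
    (\<forall>l\<in>{1..k}. \<forall>i\<in>{r+1..r+w}. \<rho> l div n \<le> (\<Sum>j\<in>{1..r+w}. of_bool (T i j = l)) \<and>
        (\<Sum>j\<in>{1..r+w}. of_bool (T i j = l)) \<le> c l) \<and>
    (\<forall>l\<in>{1..k}. (\<Sum>i\<in>{r+1..r+w}. \<Sum>j\<in>{1..r+w}. of_bool (T i j = l)) =
        (\<Sum>i\<in>{1..r}. b i l) + e l + 2 * g l) \<and>
    (\<forall>l\<in>{1..k}. (\<Sum>i\<in>{r+1..r+w}. of_bool (T i i = l)) = e l)"
  proof (rule symmetric_tail)
    show "c l \<le> Suc (\<rho> l div n)" for l by (simp add: c_def)
    show "w * (\<rho> l div n) \<le> (\<Sum>i\<in>{1..r}. b i l) + e l + 2 * g l"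
      "(\<Sum>i\<in>{1..r}. b i l) + e l + 2 * g l \<le> w * c l" if "l \<in> {1..k}" for l
      unfolding D[OF that] using key[OF that] by linarith+
  qed (use b_row eg in simp_all)
  then obtain T where "\<forall>i j. T i j = T j i"
    "\<forall>i\<in>{r+1..n}. \<forall>j\<in>{1..n}. T i j \<in> {1..k}"
    "\<forall>l\<in>{1..k}. \<forall>i\<in>{1..r}. (\<Sum>j\<in>{r+1..n}. of_bool (T i j = l)) = b i l"
    "\<forall>l\<in>{1..k}. \<forall>i\<in>{r+1..n}. \<rho> l div n \<le> (\<Sum>j\<in>{1..n}. of_bool (T i j = l)) \<and>
        (\<Sum>j\<in>{1..n}. of_bool (T i j = l)) \<le> c l"
    "\<forall>l\<in>{1..k}. (\<Sum>i\<in>{r+1..n}. \<Sum>j\<in>{1..n}. of_bool (T i j = l)) =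
        (\<Sum>i\<in>{1..r}. b i l) + e l + 2 * g l"
    "\<forall>l\<in>{1..k}. (\<Sum>i\<in>{r+1..n}. of_bool (T i i = l)) = e l"
    unfolding n[symmetric] by (elim exE conjE) (rule that, assumption+)
  note T = this[rule_format]
  define N where "N i j = (if i \<le> r \<and> j \<le> r then M i j else T i j)" for i j
  have N_late: "N i j = T i j" "N j i = T i j" if "i \<in> {r+1..n}" for i j
    using that T(1) by (auto simp: N_def)
  have ext: "array_extends r M N" by (simp add: array_extends_def N_def)
  have row_late: "row_occ n N l i = (\<Sum>j\<in>{1..n}. of_bool (T i j = l))" if "i \<in> {r+1..n}" for i l
    unfolding row_occ_eq_sum using N_late[OF that] by simp
  have row_early: "row_occ n N l i = row_occ r M l i + b i l" if "i \<in> {1..r}" "l \<in> {1..k}" for i l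
  proof -
    have "(\<Sum>j\<in>{r+1..n}. of_bool (N i j = l)) = (\<Sum>j\<in>{r+1..n}. of_bool (T i j = l) :: nat)"
      by (intro sum.cong) (auto simp: N_def)
    then show ?thesis using row_occ_extends[OF ext that(1) r_le] T(3)[OF that(2,1)] by simp
  qed
  have ivl: "{1..n} = {1..r} \<union> {r+1..n}" using r_le by auto
  \<comment> \<open>External symmetry enters here: columns of \<open>M\<close> count like its rows,
    and the rest is mirrored, so row bounds carry over to columns.\<close>
  have col_eq_row: "col_occ n N l i = row_occ n N l i" if i: "i \<in> {1..n}" and l: "l \<in> {1..k}" for i l
  proof (cases "i \<le> r")
    case True
    then have i': "i \<in> {1..r}" using i by simp
    have "col_occ n N l i = (\<Sum>j\<in>{1..r}. of_bool (N j i = l)) + (\<Sum>j\<in>{r+1..n}. of_bool (N j i = l))"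
      unfolding col_occ_eq_sum ivl by (rule sum.union_disjoint) auto
    also have "(\<Sum>j\<in>{1..r}. of_bool (N j i = l)) = col_occ r M l i"
      unfolding col_occ_eq_sum using i' by (intro sum.cong) (auto simp: N_def)
    also have "\<dots> = row_occ r M l i"
      using ext_sym i' l by (simp add: externally_symmetric_def)
    also have "(\<Sum>j\<in>{r+1..n}. of_bool (N j i = l)) = (\<Sum>j\<in>{r+1..n}. of_bool (N i j = l) :: nat)"
      using N_late by (intro sum.cong) auto
    finally show ?thesis using row_occ_extends[OF ext i' r_le] by simp
  next
    case False
    then have "i \<in> {r+1..n}" using i by simp
    then show ?thesis unfolding col_occ_eq_sum row_occ_eq_sum using N_late by simp
  qed
  have occ: "occ n N l = \<rho> l" if l: "l \<in> {1..k}" for l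
  proof -
    have "occ n N l = (\<Sum>i\<in>{1..r}. row_occ n N l i) + (\<Sum>i\<in>{r+1..n}. row_occ n N l i)"
      unfolding occ_eq_sum ivl by (rule sum.union_disjoint) auto
    also have "(\<Sum>i\<in>{1..r}. row_occ n N l i) = occ r M l + E l"
      unfolding occ_eq_sum E_def sum.distrib[symmetric] using row_early l by (intro sum.cong) auto
    also have "(\<Sum>i\<in>{r+1..n}. row_occ n N l i) = \<rho> l - occ r M l - E l"
      unfolding D[OF l, symmetric] T(5)[OF l, symmetric] using row_late by (intro sum.cong) auto
    finally show ?thesis using \<tau>(1)[OF l] by linarith
  qed
  have bounds: "\<rho> l div n \<le> row_occ n N l i \<and> row_occ n N l i \<le> c l"
    if i: "i \<in> {1..n}" and l: "l \<in> {1..k}" for i l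
  proof (cases "i \<le> r")
    case True
    then have i': "i \<in> {1..r}" using i by simp
    show ?thesis
      using row_early[OF i' l] b[OF i' l] x[OF i' l] c_free[of l] c_forced[of l] l
      by (cases "l \<in> Y"; cases "row_occ r M l i < c l") auto
  next
    case False
    then have "i \<in> {r+1..n}" using i by simp
    then show ?thesis using T(4)[OF l] row_late by simp
  qed
  have "symbols_from n k N"
    unfolding symbols_from_def
  proof (intro ballI)
    fix i j assume ij: "i \<in> {1..n}" "j \<in> {1..n}"
    then consider "i \<in> {1..r}" "j \<in> {1..r}" | "i \<in> {r+1..n}" | "j \<in> {r+1..n}" by fastforce
    then show "N i j \<in> {1..k}"
    proof cases
      case 1
      then show ?thesis using rect
        by (simp add: N_def equitable_latin_rectangle_def symbols_from_def)
    next
      case 2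
      then show ?thesis using N_late(1)[OF 2] T(2)[OF 2 ij(2)] by simp
    next
      case 3
      then show ?thesis using N_late(2)[OF 3] T(2)[OF 3 ij(1)] by simp
    qed
  qed
  then have "equitable_latin_square n k \<rho> N"
    using occ bounds col_eq_row unfolding equitable_latin_square_def floor_\<rho> ceiling_\<rho> by simp
  moreover have "symmetric_off n r N"
    unfolding symmetric_off_def by (intro conjI ballI) (metis N_late)+
  moreover have "has_diagonal_tail n k r d N"
    unfolding has_diagonal_tail_def
  proof
    fix l assume l: "l \<in> {1..k}"
    have "card {i \<in> {r+1..n}. N i i = l} = (\<Sum>i\<in>{r+1..n}. of_bool (N i i = l))" by (simp add: Int_def)
    also have "\<dots> = (\<Sum>i\<in>{r+1..n}. of_bool (T i i = l))" using N_late by (intro sum.cong) auto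
    also have "\<dots> = e l" using T(6)[OF l] by simp
    finally show "d l \<le> card {i \<in> {r+1..n}. N i i = l}" using eg(1)[OF l] by simp
  qed
  ultimately show ?thesis using ext by blast
qed

end

theorem theorem1p3:
  fixes r k n :: nat and \<rho> d :: "nat \<Rightarrow> nat" and Y :: "nat set" and M :: array
  assumes "1 \<le> k" and "1 \<le> n" and "r \<le> n" and "k \<le> n ^ 2"
    and "\<forall>l\<in>{1..k}. 1 \<le> \<rho> l"
    and "(\<Sum>l\<in>{1..k}. \<rho> l) = n ^ 2"
    and "(\<Sum>l\<in>{1..k}. d l) \<le> n - r"
    and "Y = {l \<in> {1..k}. \<not> n dvd \<rho> l}"
    and "equitable_latin_rectangle n k \<rho> r M"
    and "externally_symmetric k r M"
  shows
    "(\<exists>N. equitable_latin_square n k \<rho> N \<and> array_extends r M N \<and>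
          symmetric_off n r N \<and> has_diagonal_tail n k r d N)
     \<longleftrightarrow>
     equitably_admissible n k \<rho> d r M \<and>
     (\<forall>I. I \<subseteq> {1..r} \<longrightarrow>
        int (card I) * ((\<Sum>l\<in>{1..k}. \<lceil>real (\<rho> l) / real n\<rceil>) - int n)
        \<le> (\<Sum>l\<in>Y. min (int n * \<lceil>real (\<rho> l) / real n\<rceil> - int (\<rho> l))
                        (int (eta_rows n \<rho> r M I l)))) \<and>
     (\<forall>K. K \<subseteq> Y \<longrightarrow>
        (\<Sum>l\<in>K. Max
           {int r * \<lceil>real (\<rho> l) / real n\<rceil>
              - \<lfloor>(real (\<rho> l) + real (occ r M l) - real (d l)) / 2\<rfloor>,
            int r * (\<lceil>real (\<rho> l) / real n\<rceil> - \<lfloor>real (\<rho> l) / real n\<rfloor>)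
              + int n * \<lfloor>real (\<rho> l) / real n\<rfloor> - int (\<rho> l),
            0})
        \<le> (\<Sum>i\<in>{1..r}. min ((\<Sum>l\<in>{1..k}. \<lceil>real (\<rho> l) / real n\<rceil>) - int n)
                              (int (eta_symbols n \<rho> r M K i))))"
proof -
  interpret P: extension_problem r k n \<rho> d M
    using assms by unfold_locales auto
  have Y: "Y = P.Y" using assms(8) by (simp add: P.Y_def)
  have rows: "eta_rows n \<rho> r M I l = card {i \<in> I. row_occ r M l i < P.c l}" if "l \<in> P.Y" for I l
    using that by (simp add: eta_rows_def free_symbol_def P.Y_def P.ceiling_\<rho>)
  have syms: "eta_symbols n \<rho> r M K i = card {l \<in> K. row_occ r M l i < P.c l}" if "K \<subseteq> P.Y" for K i
    unfolding eta_symbols_def P.ceiling_\<rho> using that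
    by (intro arg_cong[of _ _ card]) (auto simp: free_symbol_def P.Y_def)
  have "P.row_condition \<longleftrightarrow> (\<forall>I. I \<subseteq> {1..r} \<longrightarrow>
        int (card I) * ((\<Sum>l\<in>{1..k}. \<lceil>real (\<rho> l) / real n\<rceil>) - int n)
        \<le> (\<Sum>l\<in>Y. min (int n * \<lceil>real (\<rho> l) / real n\<rceil> - int (\<rho> l))
                        (int (eta_rows n \<rho> r M I l))))"
    unfolding P.row_condition_def P.excess_def Y P.ceiling_\<rho> by (simp add: rows)
  moreover have "P.symbol_condition \<longleftrightarrow> (\<forall>K. K \<subseteq> Y \<longrightarrow>
        (\<Sum>l\<in>K. Max
           {int r * \<lceil>real (\<rho> l) / real n\<rceil>
              - \<lfloor>(real (\<rho> l) + real (occ r M l) - real (d l)) / 2\<rfloor>,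
            int r * (\<lceil>real (\<rho> l) / real n\<rceil> - \<lfloor>real (\<rho> l) / real n\<rfloor>)
              + int n * \<lfloor>real (\<rho> l) / real n\<rfloor> - int (\<rho> l),
            0})
        \<le> (\<Sum>i\<in>{1..r}. min ((\<Sum>l\<in>{1..k}. \<lceil>real (\<rho> l) / real n\<rceil>) - int n)
                              (int (eta_symbols n \<rho> r M K i))))"
    unfolding P.symbol_condition_def P.lower_def P.excess_def Y P.ceiling_\<rho> P.floor_\<rho>
    by (simp add: syms)
  ultimately show ?thesis
    using P.conditions_of_extension P.extension_of_conditions by blast
qed

end
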